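(* Let $X$ be a connected locally path-connected topological space and $f : X \to \mathbb{R}$ a continuous function whose Reeb graph $R_f$ is a finite topological graph. Then the cycle rank $b_1(R_f)$ satisfies $$b_1(R_f) \le b'_1(X),$$ where $b'_1(X) = \operatorname{corank}(\pi_1(X))$.
   Context: A contour of $f : X \to \mathbb{R}$ is a connected component of a level set $f^{-1}(y)$, $y \in \mathbb{R}$. The Reeb graph $R_f$ of $f$ is the quotient space $X/\sim$ with the quotient topology, where $x \sim y$ iff $x$ and $y$ lie in the same contour of $f$. A finite topological graph is a topological space homeomorphic to the geometric realization of a finite graph (a finite one-dimensional CW complex). The cycle rank of $R_f$ is its first Betti number $b_1(R_f)$. The co-rank of a group $G$, $\operatorname{corank}(G)$, is the supremum (in $\{0,1,2,\dots\}\cup\{\infty\}$) of the ranks of free groups that are homomorphic images of $G$; for finitely generated $G$ it is a maximum. *)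

theory Defs
  imports "HOL-Homology.Homology" "HOL-Library.Extended_Nat"
begin

section \<open>Reeb graphs\<close>

definition quotient_topology :: "'a topology \<Rightarrow> ('a \<Rightarrow> 'b) \<Rightarrow> 'b topology" where
  "quotient_topology T q =
     topology (\<lambda>U. U \<subseteq> q ` topspace T \<and> openin T {x \<in> topspace T. q x \<in> U})"

lemma openin_quotient_topology:
  "openin (quotient_topology T q) U \<longleftrightarrow>
     U \<subseteq> q ` topspace T \<and> openin T {x \<in> topspace T. q x \<in> U}"
proof -
  have "istopology (\<lambda>U. U \<subseteq> q ` topspace T \<and> openin T {x \<in> topspace T. q x \<in> U})"
    unfolding istopology_def
  proof (intro conjI allI impI; (elim conjE)?)
    fix U V assume "openin T {x \<in> topspace T. q x \<in> U}" "openin T {x \<in> topspace T. q x \<in> V}"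
    moreover have "{x \<in> topspace T. q x \<in> U \<inter> V} =
        {x \<in> topspace T. q x \<in> U} \<inter> {x \<in> topspace T. q x \<in> V}"
      by blast
    ultimately show "openin T {x \<in> topspace T. q x \<in> U \<inter> V}"
      by (simp only: openin_Int)
  next
    fix \<K> assume K: "\<forall>K\<in>\<K>. K \<subseteq> q ` topspace T \<and> openin T {x \<in> topspace T. q x \<in> K}"
    have "openin T (\<Union>K\<in>\<K>. {x \<in> topspace T. q x \<in> K})"
      using K by (intro openin_Union) fast
    moreover have "{x \<in> topspace T. q x \<in> \<Union>\<K>} = (\<Union>K\<in>\<K>. {x \<in> topspace T. q x \<in> K})"
      by blast
    ultimately show "openin T {x \<in> topspace T. q x \<in> \<Union>\<K>}"
      by (simp only:)
    show "\<Union>\<K> \<subseteq> q ` topspace T"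
      using K by (intro Union_least) fast
  qed fast
  then show ?thesis
    by (simp add: quotient_topology_def topology_inverse')
qed

lemma topspace_quotient_topology [simp]:
  "topspace (quotient_topology T q) = q ` topspace T"
proof
  have "{x \<in> topspace T. q x \<in> q ` topspace T} = topspace T"
    by blast
  then have "openin (quotient_topology T q) (q ` topspace T)"
    by (simp add: openin_quotient_topology)
  then show "q ` topspace T \<subseteq> topspace (quotient_topology T q)"
    by (rule openin_subset)
  show "topspace (quotient_topology T q) \<subseteq> q ` topspace T"
    using openin_quotient_topology[THEN iffD1, OF openin_topspace] by (rule conjunct1)
qed

lemma quotient_map_quotient_topology: "quotient_map T (quotient_topology T q) q"
  by (simp add: quotient_map_def openin_quotient_topology)

text \<open>The contour of \<open>f\<close> through \<open>x \<in> X\<close>.\<close>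

definition contour :: "'a::topological_space set \<Rightarrow> ('a \<Rightarrow> real) \<Rightarrow> 'a \<Rightarrow> 'a set" where
  "contour X f x = connected_component_set {z \<in> X. f z = f x} x"

definition Reeb_graph :: "'a::topological_space set \<Rightarrow> ('a \<Rightarrow> real) \<Rightarrow> 'a set topology" where
  "Reeb_graph X f = quotient_topology (top_of_set X) (contour X f)"

section \<open>Finite topological graphs\<close>

text \<open>
  A graph, possibly with loops and parallel edges, is given by its vertex set \<open>V\<close>, its edge set
  \<open>E\<close> and the two ends \<open>s e\<close> and \<open>t e\<close> of every edge \<open>e\<close>; which end is called \<open>s e\<close> is an
  arbitrary choice. In its geometric realization the points of the open edge \<open>e\<close> are
  \<open>Inr (e, r)\<close> with \<open>0 < r < 1\<close>, and the topology is the weak topology of a CW complex: a set is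
  open iff its preimage under the characteristic map \<open>[0, 1] \<rightarrow> |G|\<close> of every edge is open
  (vertices are 0-cells and impose no condition).
\<close>

definition edge_map :: "('e \<Rightarrow> 'v) \<Rightarrow> ('e \<Rightarrow> 'v) \<Rightarrow> 'e \<Rightarrow> real \<Rightarrow> 'v + 'e \<times> real" where
  "edge_map s t e r = (if r = 0 then Inl (s e) else if r = 1 then Inl (t e) else Inr (e, r))"

definition graph_realization ::
    "'v set \<Rightarrow> 'e set \<Rightarrow> ('e \<Rightarrow> 'v) \<Rightarrow> ('e \<Rightarrow> 'v) \<Rightarrow> ('v + 'e \<times> real) topology" where
  "graph_realization V E s t =
     topology (\<lambda>U. U \<subseteq> Inl ` V \<union> Inr ` (E \<times> {0<..<1}) \<and>
       (\<forall>e\<in>E. openin (top_of_set {0..1}) {r \<in> {0..1}. edge_map s t e r \<in> U}))"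

lemma openin_graph_realization:
  "openin (graph_realization V E s t) U \<longleftrightarrow>
     U \<subseteq> Inl ` V \<union> Inr ` (E \<times> {0<..<1}) \<and>
     (\<forall>e\<in>E. openin (top_of_set {0..1}) {r \<in> {0..1}. edge_map s t e r \<in> U})"
proof -
  define P where "P = (\<lambda>U e. {r \<in> {0..1}. edge_map s t e r \<in> U})"
  define Q where "Q = (\<lambda>U. U \<subseteq> Inl ` V \<union> Inr ` (E \<times> {0<..<1}) \<and> (\<forall>e\<in>E. openin (top_of_set {0..1}) (P U e)))"
  have "istopology Q"
    unfolding istopology_def
  proof (intro conjI allI impI)
    fix U W assume UW: "Q U" "Q W"
    have "P (U \<inter> W) e = P U e \<inter> P W e" for e
      by (auto simp: P_def)
    with UW show "Q (U \<inter> W)"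
      by (auto simp: Q_def)
  next
    fix \<K> assume K: "\<forall>K\<in>\<K>. Q K"
    have "P (\<Union>\<K>) e = (\<Union>K\<in>\<K>. P K e)" for e
      by (auto simp: P_def)
    moreover have "openin (top_of_set {0..1}) (\<Union>K\<in>\<K>. P K e)" if "e \<in> E" for e
      using K that unfolding Q_def by (intro openin_Union) auto
    moreover have "\<Union>\<K> \<subseteq> Inl ` V \<union> Inr ` (E \<times> {0<..<1})"
      using K unfolding Q_def by (intro Union_least) metis
    ultimately show "Q (\<Union>\<K>)"
      by (simp add: Q_def)
  qed
  moreover have "graph_realization V E s t = topology Q"
    by (simp only: graph_realization_def Q_def P_def)
  ultimately have "openin (graph_realization V E s t) U = Q U"
    by (simp add: topology_inverse')
  then show ?thesis
    by (simp only: Q_def P_def)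
qed

lemma topspace_graph_realization:
  assumes "s \<in> E \<rightarrow> V" "t \<in> E \<rightarrow> V"
  shows "topspace (graph_realization V E s t) = Inl ` V \<union> Inr ` (E \<times> {0<..<1})"
proof
  have "{r \<in> {0..1}. edge_map s t e r \<in> Inl ` V \<union> Inr ` (E \<times> {0<..<1})} = {0..1}" if "e \<in> E" for e
    using assms that by (auto simp: edge_map_def)
  then have "openin (graph_realization V E s t) (Inl ` V \<union> Inr ` (E \<times> {0<..<1}))"
    by (simp add: openin_graph_realization)
  then show "Inl ` V \<union> Inr ` (E \<times> {0<..<1}) \<subseteq> topspace (graph_realization V E s t)"
    by (rule openin_subset)
  show "topspace (graph_realization V E s t) \<subseteq> Inl ` V \<union> Inr ` (E \<times> {0<..<1})"
    using openin_graph_realization[THEN iffD1, OF openin_topspace] by (rule conjunct1)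
qed

definition finite_topological_graph :: "'a topology \<Rightarrow> bool" where
  "finite_topological_graph R \<longleftrightarrow>
     (\<exists>(V :: nat set) (E :: nat set) s t.
        finite V \<and> finite E \<and> s \<in> E \<rightarrow> V \<and> t \<in> E \<rightarrow> V \<and>
        R homeomorphic_space graph_realization V E s t)"

section \<open>Betti numbers\<close>

text \<open>The rank of an abelian group: the maximal size of a subset that is linearly independent
  over the integers.\<close>

definition int_independent :: "('a, 'm) monoid_scheme \<Rightarrow> 'a set \<Rightarrow> bool" where
  "int_independent G B \<longleftrightarrow>
     (\<forall>c :: 'a \<Rightarrow> int. finprod G (\<lambda>b. b [^]\<^bsub>G\<^esub> c b) B = \<one>\<^bsub>G\<^esub> \<longrightarrow> (\<forall>b\<in>B. c b = 0))"

definition abelian_rank :: "('a, 'm) monoid_scheme \<Rightarrow> enat" where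
  "abelian_rank G =
     (SUP B \<in> {B. finite B \<and> B \<subseteq> carrier G \<and> int_independent G B}. enat (card B))"

definition betti_number :: "int \<Rightarrow> 'a topology \<Rightarrow> enat" where
  "betti_number p T = abelian_rank (homology_group p T)"

section \<open>The co-rank of a group\<close>

text \<open>
  The free group on \<open>S\<close> consists of the reduced words in the letters \<open>(x, True)\<close>, standing for
  \<open>x\<close>, and \<open>(x, False)\<close>, standing for the inverse of \<open>x\<close>, with \<open>x \<in> S\<close>. Two words are multiplied
  by putting the letters of the first one, from the last to the first, in front of the second,
  each time cancelling a letter against its inverse.
\<close>

definition reduced_word :: "('a \<times> bool) list \<Rightarrow> bool" where
  "reduced_word = successively (\<lambda>(x, b) (y, c). x = y \<longrightarrow> b = c)"

fun push_letter :: "'a \<times> bool \<Rightarrow> ('a \<times> bool) list \<Rightarrow> ('a \<times> bool) list" where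
  "push_letter a [] = [a]"
| "push_letter (x, b) ((y, c) # w) = (if x = y \<and> b \<noteq> c then w else (x, b) # (y, c) # w)"

definition free_group :: "'a set \<Rightarrow> ('a \<times> bool) list monoid" where
  "free_group S =
     \<lparr>carrier = {w. set w \<subseteq> S \<times> UNIV \<and> reduced_word w},
      monoid.mult = foldr push_letter,
      one = []\<rparr>"

lemma reduced_word_Cons:
  "reduced_word (a # w) \<Longrightarrow> reduced_word w"
  by (cases w) (auto simp: reduced_word_def)

lemma reduced_word_push_letter:
  "reduced_word w \<Longrightarrow> reduced_word (push_letter a w)"
  by (cases "(a, w)" rule: push_letter.cases)
     (auto simp: reduced_word_def successively_Cons)

lemma push_letter_inverse:
  "reduced_word w \<Longrightarrow> push_letter (x, b) (push_letter (x, \<not> b) w) = w"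
  by (cases "((x, b), w)" rule: push_letter.cases; cases "tl w")
     (auto simp: reduced_word_def)

lemma push_letter_reduced:
  "reduced_word (a # w) \<Longrightarrow> push_letter a w = a # w"
  by (cases "(a, w)" rule: push_letter.cases) (auto simp: reduced_word_def)

lemma set_push_letter: "set (push_letter a w) \<subseteq> insert a (set w)"
  by (cases "(a, w)" rule: push_letter.cases) auto

lemma set_foldr_push_letter: "set (foldr push_letter u v) \<subseteq> set u \<union> set v"
proof (induction u)
  case (Cons a u)
  then show ?case using set_push_letter[of a "foldr push_letter u v"] by auto
qed simp

lemma reduced_word_foldr_push_letter:
  "reduced_word v \<Longrightarrow> reduced_word (foldr push_letter u v)"
  by (induction u) (auto intro: reduced_word_push_letter)

lemma foldr_push_letter_push_letter:
  assumes "reduced_word w"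
  shows "foldr push_letter (push_letter a v) w = push_letter a (foldr push_letter v w)"
proof (cases "(a, v)" rule: push_letter.cases)
  case (2 x b y c v')
  have "push_letter (x, b) (push_letter (x, \<not> b) (foldr push_letter v' w)) = foldr push_letter v' w"
    by (intro push_letter_inverse reduced_word_foldr_push_letter assms)
  moreover have "c = (\<not> b)" if "b \<noteq> c"
    using that by auto
  ultimately show ?thesis
    using 2 by auto
qed simp

lemma foldr_push_letter_Nil: "reduced_word w \<Longrightarrow> foldr push_letter w [] = w"
  by (induction w) (use push_letter_reduced reduced_word_Cons in force)+

lemma foldr_push_letter_assoc:
  "reduced_word w \<Longrightarrow>
     foldr push_letter (foldr push_letter u v) w = foldr push_letter u (foldr push_letter v w)"
  by (induction u) (auto simp: foldr_push_letter_push_letter)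

lemma group_free_group: "group (free_group S)"
proof (rule groupI)
  show "\<exists>v\<in>carrier (free_group S). v \<otimes>\<^bsub>free_group S\<^esub> w = \<one>\<^bsub>free_group S\<^esub>"
    if "w \<in> carrier (free_group S)" for w
  proof -
    have "set w \<subseteq> S \<times> UNIV \<Longrightarrow> reduced_word w \<Longrightarrow>
        \<exists>v. set v \<subseteq> S \<times> UNIV \<and> reduced_word v \<and> foldr push_letter v w = []"
    proof (induction w)
      case Nil
      then show ?case by (intro exI[of _ "[]"]) auto
    next
      case (Cons a w)
      obtain x b where a: "a = (x, b)" by fastforce
      from Cons obtain v where v: "set v \<subseteq> S \<times> UNIV" "reduced_word v" "foldr push_letter v w = []"
        using reduced_word_Cons[of a w] by auto
      let ?u = "foldr push_letter v [(x, \<not> b)]"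
      have "foldr push_letter ?u (a # w) = foldr push_letter v (push_letter (x, \<not> b) (a # w))"
        using Cons.prems by (simp add: foldr_push_letter_assoc)
      also have "\<dots> = []" using v a by simp
      finally have "foldr push_letter ?u (a # w) = []" .
      moreover have "set ?u \<subseteq> S \<times> UNIV"
        using set_foldr_push_letter[of v "[(x, \<not> b)]"] v Cons.prems a by auto
      moreover have "reduced_word ?u"
        by (rule reduced_word_foldr_push_letter) (simp add: reduced_word_def)
      ultimately show ?case by blast
    qed
    with that show ?thesis by (auto simp: free_group_def)
  qed
next
  fix u v assume "u \<in> carrier (free_group S)" "v \<in> carrier (free_group S)"
  then show "u \<otimes>\<^bsub>free_group S\<^esub> v \<in> carrier (free_group S)"
    using set_foldr_push_letter[of u v]
    by (auto simp: free_group_def reduced_word_foldr_push_letter)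
qed (auto simp: free_group_def foldr_push_letter_assoc reduced_word_def)

text \<open>
  No ranks are lost by only taking generators from the element type of \<open>G\<close>: choosing preimages of
  the generators embeds the basis of any free homomorphic image of \<open>G\<close> into the carrier of \<open>G\<close>.
\<close>

definition corank :: "('a, 'm) monoid_scheme \<Rightarrow> enat" where
  "corank G =
     (SUP S \<in> {S :: 'a set. epi G (free_group S) \<noteq> {}}. if finite S then enat (card S) else \<infinity>)"

section \<open>The fundamental group\<close>

definition loops_at :: "'a::topological_space set \<Rightarrow> 'a \<Rightarrow> (real \<Rightarrow> 'a) set" where
  "loops_at X x0 =
     {p. path p \<and> path_image p \<subseteq> X \<and> pathstart p = x0 \<and> pathfinish p = x0}"

text \<open>A path is a total function on the reals of which only the values on \<open>[0, 1]\<close> matter;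
  paths that agree on \<open>[0, 1]\<close> are homotopic, so they lie in the same homotopy class.\<close>

definition fundamental_group ::
    "'a::topological_space set \<Rightarrow> 'a \<Rightarrow> (real \<Rightarrow> 'a) set monoid" where
  "fundamental_group X x0 =
     \<lparr>carrier = (\<lambda>p. Collect (homotopic_paths X p)) ` loops_at X x0,
      monoid.mult = (\<lambda>A B. \<Union>p\<in>A. \<Union>q\<in>B. Collect (homotopic_paths X (p +++ q))),
      one = Collect (homotopic_paths X (\<lambda>_. x0))\<rparr>"

end

theory Submission
  imports Defs "HOL-Analysis.Abstract_Topological_Spaces"
begin

text \<open>
  Let \<open>q : X \<rightarrow> |G|\<close> be the quotient map onto the Reeb graph; its fibres, the contours, are connected.
  Choose a maximal set \<open>M\<close> of edges such that \<open>|G|\<close> minus the midpoints of the edges in \<open>M\<close> is still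
  connected, i.e. the complement of a spanning tree.

  Upper bound for \<open>b\<^sub>1\<close>: put back the midpoint of one edge at a time, starting from the graph cut at all
  midpoints, which deformation retracts to its vertices. By excision the relative \<open>H\<^sub>1\<close> of each step is
  infinite cyclic, so the rank grows by at most one. For an edge outside \<open>M\<close> the two half edges lie in
  different clopen parts of the cut graph, so there is a map of pairs to the open interval which is an
  isomorphism on the relative \<open>H\<^sub>1\<close>; as the interval has trivial \<open>H\<^sub>1\<close>, such a step adds nothing.
  Hence \<open>b\<^sub>1 \<le> |M|\<close>.

  Lower bound for the co-rank: recording the signed crossings of the midpoints of the edges in \<open>M\<close> maps
  \<open>\<pi>\<^sub>1(X)\<close> to the free group on \<open>M\<close>. Preimages under \<open>q\<close> of open connected sets are connected and open,
  hence path connected, so there are loops in \<open>X\<close> that cross a single midpoint once up to homotopy in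
  the preimage of that edge, and the homomorphism is onto.
\<close>

section \<open>Locally constant functions\<close>

text \<open>A path in X may meet the contour over a midpoint infinitely often, so crossings cannot
  be counted one by one. Instead X is covered by the preimage of the cut graph and the preimages of
  the open edges in M, and a locally constant cocycle on this cover replaces the count: its holonomy
  along a loop is the word of crossings. This needs only lifts over paths and squares, not a
  universal cover of X, whose existence is not assumed. Loops of |G| are never lifted to X either;
  generators are assembled from paths inside the preimages of single pieces of the cover.

  The set M serves both bounds. Connectedness of the graph cut at M makes one piece of the cover
  path connected, which yields the generators; maximality makes every other edge a bridge, which
  keeps the rank from growing. Midpoints are removed rather than whole edges because the complement
  is then open, as both excision and the passage to path connected preimages require.\<close>

definition locally_constant_on :: "'z::topological_space set \<Rightarrow> ('z \<Rightarrow> 'b) \<Rightarrow> bool" where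
  "locally_constant_on D f \<longleftrightarrow> (\<forall>x\<in>D. \<exists>N. open N \<and> x \<in> N \<and> (\<forall>y\<in>N \<inter> D. f y = f x))"

lemma locally_constant_on_subset:
  assumes "locally_constant_on D f" "E \<subseteq> D"
  shows "locally_constant_on E f"
  unfolding locally_constant_on_def
proof
  fix x assume "x \<in> E"
  with assms obtain N where "open N" "x \<in> N" "\<forall>y\<in>N \<inter> D. f y = f x"
    unfolding locally_constant_on_def by (meson subsetD)
  with assms(2) show "\<exists>N. open N \<and> x \<in> N \<and> (\<forall>y\<in>N \<inter> E. f y = f x)"
    by (intro exI[of _ N] conjI) blast+
qed

lemma locally_constant_on_const [simp]: "locally_constant_on D (\<lambda>_. a)"
  unfolding locally_constant_on_def by (intro ballI exI[of _ UNIV]) simp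

lemma locally_constant_on_cong:
  assumes "locally_constant_on D f" "\<And>x. x \<in> D \<Longrightarrow> f x = g x"
  shows "locally_constant_on D g"
  unfolding locally_constant_on_def
proof
  fix x assume x: "x \<in> D"
  with assms(1) obtain N where "open N" "x \<in> N" "\<forall>y\<in>N \<inter> D. f y = f x"
    unfolding locally_constant_on_def by meson
  with assms(2) x show "\<exists>N. open N \<and> x \<in> N \<and> (\<forall>y\<in>N \<inter> D. g y = g x)"
    by (intro exI[of _ N] conjI ballI) (assumption, assumption, metis IntD2)
qed

lemma locally_constant_on_compose2:
  assumes "locally_constant_on D f" "locally_constant_on D g"
  shows "locally_constant_on D (\<lambda>x. k (f x) (g x))"
  unfolding locally_constant_on_def
proof
  fix x assume "x \<in> D"
  with assms obtain M N where "open M" "x \<in> M" "\<forall>y\<in>M \<inter> D. f y = f x"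
    "open N" "x \<in> N" "\<forall>y\<in>N \<inter> D. g y = g x"
    unfolding locally_constant_on_def by meson
  then show "\<exists>N. open N \<and> x \<in> N \<and> (\<forall>y\<in>N \<inter> D. k (f y) (g y) = k (f x) (g x))"
    by (intro exI[of _ "M \<inter> N"] conjI open_Int ballI arg_cong2[where f = k]) blast+
qed

lemma locally_constant_on_continuous_compose:
  assumes "locally_constant_on E f" "continuous_on D h" "h ` D \<subseteq> E"
  shows "locally_constant_on D (\<lambda>x. f (h x))"
  unfolding locally_constant_on_def
proof
  fix x assume x: "x \<in> D"
  with assms obtain N where N: "open N" "h x \<in> N" "\<forall>y\<in>N \<inter> E. f y = f (h x)"
    unfolding locally_constant_on_def by blast
  from assms(2) N(1) obtain M where M: "open M" "M \<inter> D = h -` N \<inter> D"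
    unfolding continuous_on_open_invariant by blast
  show "\<exists>N. open N \<and> x \<in> N \<and> (\<forall>y\<in>N \<inter> D. f (h y) = f (h x))"
  proof (intro exI[of _ M] conjI ballI)
    show "x \<in> M"
      using M(2) N(2) x by blast
    fix y assume "y \<in> M \<inter> D"
    then have "h y \<in> N \<inter> E"
      using M(2) assms(3) by blast
    then show "f (h y) = f (h x)"
      using N(3) by blast
  qed (fact M(1))
qed

lemma locally_constant_on_connected:
  assumes "locally_constant_on D f" "connected D" "x \<in> D" "y \<in> D"
  shows "f x = f y"
proof -
  have op: "openin (top_of_set D) {z \<in> D. P (f z)}" for P
  proof (subst openin_subopen, intro ballI)
    fix z assume z: "z \<in> {z \<in> D. P (f z)}"
    with assms(1) obtain N where N: "open N" "z \<in> N" "\<forall>y\<in>N \<inter> D. f y = f z"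
      unfolding locally_constant_on_def by blast
    have "D \<inter> N \<subseteq> {z \<in> D. P (f z)}"
    proof
      fix y assume y: "y \<in> D \<inter> N"
      with N(3) have "f y = f z" by blast
      with y z show "y \<in> {z \<in> D. P (f z)}" by simp
    qed
    moreover have "openin (top_of_set D) (D \<inter> N)" "z \<in> D \<inter> N"
      using N z by (auto simp: openin_open_Int)
    ultimately show "\<exists>T. openin (top_of_set D) T \<and> z \<in> T \<and> T \<subseteq> {z \<in> D. P (f z)}"
      by blast
  qed
  show ?thesis
  proof (rule ccontr)
    assume "f x \<noteq> f y"
    then have "\<exists>E1 E2. openin (top_of_set D) E1 \<and> openin (top_of_set D) E2 \<and>
        D \<subseteq> E1 \<union> E2 \<and> E1 \<inter> E2 = {} \<and> E1 \<noteq> {} \<and> E2 \<noteq> {}"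
      using op[of "\<lambda>u. u = f x"] op[of "\<lambda>u. u \<noteq> f x"] assms(3,4)
      by (intro exI[of _ "{z \<in> D. f z = f x}"] exI[of _ "{z \<in> D. f z \<noteq> f x}"]) auto
    with assms(2) show False
      unfolding connected_openin by blast
  qed
qed

lemma locally_constant_on_locally:
  assumes "\<And>x. x \<in> D \<Longrightarrow> \<exists>N. open N \<and> x \<in> N \<and> locally_constant_on (D \<inter> N) f"
  shows "locally_constant_on D f"
  unfolding locally_constant_on_def
proof
  fix x assume x: "x \<in> D"
  with assms obtain N where N: "open N" "x \<in> N" "locally_constant_on (D \<inter> N) f" by blast
  then obtain M where "open M" "x \<in> M" "\<forall>y\<in>M \<inter> (D \<inter> N). f y = f x"
    unfolding locally_constant_on_def using x by blast
  with N show "\<exists>N. open N \<and> x \<in> N \<and> (\<forall>y\<in>N \<inter> D. f y = f x)"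
    by (intro exI[of _ "M \<inter> N"] conjI open_Int) blast+
qed

lemma locally_constant_on_Un:
  assumes "locally_constant_on A f" "locally_constant_on B f"
    and "closedin (top_of_set (A \<union> B)) A" "closedin (top_of_set (A \<union> B)) B"
  shows "locally_constant_on (A \<union> B) f"
proof -
  have *: "\<exists>N. open N \<and> x \<in> N \<and> (\<forall>y\<in>N \<inter> C. f y = f x)"
    if "locally_constant_on C f" "closedin (top_of_set (A \<union> B)) C" "x \<in> A \<union> B" for C x
  proof (cases "x \<in> C")
    case True
    with that(1) show ?thesis
      unfolding locally_constant_on_def by (rule bspec)
  next
    case False
    \<comment> \<open>Off the closed piece \<open>C\<close>, the complement of \<open>T\<close> is a
      neighbourhood on which the condition is vacuous.\<close>
    from that(2) obtain T where "closed T" "C = (A \<union> B) \<inter> T"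
      by (auto simp: closedin_closed)
    with that(3) False show ?thesis
      by (intro exI[of _ "- T"]) auto
  qed
  show ?thesis
    unfolding locally_constant_on_def
  proof
    fix x assume x: "x \<in> A \<union> B"
    obtain M N where "open M" "x \<in> M" "\<forall>y\<in>M \<inter> A. f y = f x" "open N" "x \<in> N" "\<forall>y\<in>N \<inter> B. f y = f x"
      using *[OF assms(1,3) x] *[OF assms(2,4) x] by metis
    then show "\<exists>N. open N \<and> x \<in> N \<and> (\<forall>y\<in>N \<inter> (A \<union> B). f y = f x)"
      by (intro exI[of _ "M \<inter> N"] conjI open_Int) blast+
  qed
qed

section \<open>Holonomy of a locally constant cocycle\<close>

text \<open>
  The principal bundle with discrete structure group \<open>F\<close> given by the locally constant transition
  functions \<open>(c j)\<^sup>-\<^sup>1 c k\<close>: a point over \<open>x\<close> is an element \<open>g\<close> of \<open>F\<close>, and \<open>g \<otimes> c j x\<close> is its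
  coordinate in the trivialization over \<open>U j\<close>. A lift of \<open>h\<close> is a map that is locally constant in
  every trivialization.
\<close>

locale cocycle = group F for F :: "('b, 'm) monoid_scheme" (structure) +
  fixes X :: "'a::topological_space set" and J :: "'j set" and U :: "'j \<Rightarrow> 'a set"
    and c :: "'j \<Rightarrow> 'a \<Rightarrow> 'b"
  assumes openin_U: "j \<in> J \<Longrightarrow> openin (top_of_set X) (U j)"
    and cover: "X \<subseteq> \<Union>(U ` J)"
    and c_closed [simp]: "j \<in> J \<Longrightarrow> x \<in> U j \<Longrightarrow> c j x \<in> carrier F"
    and transition: "j \<in> J \<Longrightarrow> k \<in> J \<Longrightarrow> locally_constant_on (U j \<inter> U k) (\<lambda>x. inv (c j x) \<otimes> c k x)"
begin

section \<open>Lifts: uniqueness, gluing and existence\<close>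

definition lift :: "'z::topological_space set \<Rightarrow> ('z \<Rightarrow> 'a) \<Rightarrow> ('z \<Rightarrow> 'b) \<Rightarrow> bool" where
  "lift D h g \<longleftrightarrow> g \<in> D \<rightarrow> carrier F \<and>
     (\<forall>j\<in>J. locally_constant_on {z \<in> D. h z \<in> U j} (\<lambda>z. g z \<otimes> c j (h z)))"

lemma lift_closed: "lift D h g \<Longrightarrow> z \<in> D \<Longrightarrow> g z \<in> carrier F"
  unfolding lift_def by blast

lemma liftD:
  "lift D h g \<Longrightarrow> j \<in> J \<Longrightarrow> E \<subseteq> D \<Longrightarrow> h ` E \<subseteq> U j \<Longrightarrow> locally_constant_on E (\<lambda>z. g z \<otimes> c j (h z))"
  unfolding lift_def by (rule locally_constant_on_subset[of "{z \<in> D. h z \<in> U j}"]) auto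

lemma liftI:
  "(\<And>z. z \<in> D \<Longrightarrow> g z \<in> carrier F) \<Longrightarrow>
   (\<And>j. j \<in> J \<Longrightarrow> locally_constant_on {z \<in> D. h z \<in> U j} (\<lambda>z. g z \<otimes> c j (h z))) \<Longrightarrow> lift D h g"
  unfolding lift_def by blast

lemma lift_subset: "lift D h g \<Longrightarrow> E \<subseteq> D \<Longrightarrow> lift E h g"
  by (rule liftI) (auto intro: lift_closed liftD)

lemma lift_compose:
  assumes "lift D h g" "continuous_on E \<phi>" "\<phi> ` E \<subseteq> D"
  shows "lift E (\<lambda>z. h (\<phi> z)) (\<lambda>z. g (\<phi> z))"
proof (rule liftI)
  fix j assume j: "j \<in> J"
  show "locally_constant_on {z \<in> E. h (\<phi> z) \<in> U j} (\<lambda>z. g (\<phi> z) \<otimes> c j (h (\<phi> z)))"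
  proof (rule locally_constant_on_continuous_compose)
    show "locally_constant_on {z \<in> D. h z \<in> U j} (\<lambda>z. g z \<otimes> c j (h z))"
      by (rule liftD[OF assms(1) j]) auto
    show "continuous_on {z \<in> E. h (\<phi> z) \<in> U j} \<phi>"
      by (rule continuous_on_subset[OF assms(2)]) auto
  qed (use assms(3) in auto)
qed (use assms(1,3) in \<open>blast intro: lift_closed\<close>)

lemma lift_cong:
  assumes "lift D h g" "\<And>z. z \<in> D \<Longrightarrow> h z = h' z"
  shows "lift D h' g"
proof (rule liftI)
  fix j assume "j \<in> J"
  then have "locally_constant_on {z \<in> D. h' z \<in> U j} (\<lambda>z. g z \<otimes> c j (h z))"
    using assms(2) by (intro liftD[OF assms(1)]) auto
  then show "locally_constant_on {z \<in> D. h' z \<in> U j} (\<lambda>z. g z \<otimes> c j (h' z))"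
    by (rule locally_constant_on_cong) (simp add: assms(2))
qed (use assms(1) in \<open>blast intro: lift_closed\<close>)

text \<open>The structure group acts on the left while the charts \<open>c j\<close> multiply on the
  right, so the two do not interfere. This is the freedom that lets two lifts be matched on an
  overlap.\<close>

lemma lift_mult_left:
  assumes "lift D h g" "a \<in> carrier F"
  shows "lift D h (\<lambda>z. a \<otimes> g z)"
proof (rule liftI)
  fix j assume j: "j \<in> J"
  then have "locally_constant_on {z \<in> D. h z \<in> U j} (\<lambda>z. g z \<otimes> c j (h z))"
    by (intro liftD[OF assms(1)]) auto
  from locally_constant_on_compose2[OF this this, of "\<lambda>u v. a \<otimes> u"]
  show "locally_constant_on {z \<in> D. h z \<in> U j} (\<lambda>z. a \<otimes> g z \<otimes> c j (h z))"
    by (rule locally_constant_on_cong) (use assms j lift_closed[OF assms(1)] in \<open>simp add: m_assoc\<close>)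
qed (use assms in \<open>blast intro: lift_closed\<close>)

lemma open_preimage_U:
  assumes "continuous_on D h" "h ` D \<subseteq> X" "x \<in> D"
  obtains j N where "j \<in> J" "open N" "x \<in> N" "h ` (D \<inter> N) \<subseteq> U j"
proof -
  from assms(2,3) cover obtain j where j: "j \<in> J" "h x \<in> U j" by blast
  from openin_U[OF j(1)] obtain T where T: "open T" "U j = X \<inter> T"
    by (auto simp: openin_open)
  from assms(1) T(1) obtain N where "open N" "N \<inter> D = h -` T \<inter> D"
    unfolding continuous_on_open_invariant by blast
  with j T assms show ?thesis
    by (intro that[of j N]) auto
qed

text \<open>The chart value cancels in \<open>(g z \<otimes> c j (h z)) \<otimes> inv (g' z
  \<otimes> c j (h z))\<close>, so the quotient of two lifts is locally constant, hence constant on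
  a connected domain.\<close>

lemma lift_unique:
  assumes "continuous_on D h" "h ` D \<subseteq> X" "lift D h g" "lift D h g'" "connected D" "x \<in> D" "y \<in> D"
  shows "g x \<otimes> inv (g' x) = g y \<otimes> inv (g' y)"
proof (rule locally_constant_on_connected[of D "\<lambda>z. g z \<otimes> inv (g' z)"])
  show "locally_constant_on D (\<lambda>z. g z \<otimes> inv (g' z))"
  proof (rule locally_constant_on_locally)
    fix z assume "z \<in> D"
    then obtain j N where jN: "j \<in> J" "open N" "z \<in> N" "h ` (D \<inter> N) \<subseteq> U j"
      using open_preimage_U assms by metis
    have g: "locally_constant_on (D \<inter> N) (\<lambda>z. g z \<otimes> c j (h z))"
      by (rule liftD[OF assms(3) jN(1)]) (use jN in auto)
    have g': "locally_constant_on (D \<inter> N) (\<lambda>z. g' z \<otimes> c j (h z))"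
      by (rule liftD[OF assms(4) jN(1)]) (use jN in auto)
    from locally_constant_on_compose2[OF g g', of "\<lambda>u v. u \<otimes> inv v"]
    have "locally_constant_on (D \<inter> N) (\<lambda>z. g z \<otimes> inv (g' z))"
    proof (rule locally_constant_on_cong)
      fix w assume "w \<in> D \<inter> N"
      then have "g w \<in> carrier F" "g' w \<in> carrier F" "c j (h w) \<in> carrier F"
        using lift_closed[OF assms(3)] lift_closed[OF assms(4)] jN by auto
      then show "(g w \<otimes> c j (h w)) \<otimes> inv (g' w \<otimes> c j (h w)) = g w \<otimes> inv (g' w)"
        by (simp add: inv_mult_group m_assoc) (simp add: m_assoc[symmetric])
    qed
    with jN show "\<exists>N. open N \<and> z \<in> N \<and> locally_constant_on (D \<inter> N) (\<lambda>z. g z \<otimes> inv (g' z))"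
      by blast
  qed
qed (use assms in auto)

text \<open>On the connected overlap the two lifts differ by a single left factor \<open>a\<close>.
  Multiplying \<open>g'\<close> by it makes them agree there, and closedness of both pieces keeps
  the union locally constant.\<close>

lemma lift_Un:
  assumes h: "continuous_on (A \<union> B) h" "h ` (A \<union> B) \<subseteq> X"
    and "lift A h g" "lift B h g'"
    and cl: "closedin (top_of_set (A \<union> B)) A" "closedin (top_of_set (A \<union> B)) B"
    and conn: "connected (A \<inter> B)"
  shows "\<exists>g. lift (A \<union> B) h g"
proof -
  obtain a where a: "a \<in> carrier F" "\<And>z. z \<in> A \<inter> B \<Longrightarrow> a \<otimes> g' z = g z"
  proof (cases "A \<inter> B = {}")
    case True
    then show ?thesis by (intro that[of \<one>]) auto
  next
    case False
    then obtain w where w: "w \<in> A \<inter> B" by blast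
    show ?thesis
    proof (rule that[of "g w \<otimes> inv (g' w)"])
      fix z assume z: "z \<in> A \<inter> B"
      have "g w \<otimes> inv (g' w) = g z \<otimes> inv (g' z)"
        using assms w z by (intro lift_unique[of "A \<inter> B" h]) (auto intro: continuous_on_subset lift_subset)
      then show "g w \<otimes> inv (g' w) \<otimes> g' z = g z"
        using z w lift_closed[OF assms(3)] lift_closed[OF assms(4)] by (simp add: m_assoc)
    qed (use w lift_closed[OF assms(3)] lift_closed[OF assms(4)] in auto)
  qed
  define k where "k z = (if z \<in> A then g z else a \<otimes> g' z)" for z
  have kB: "k z = a \<otimes> g' z" if "z \<in> B" for z
    using that a by (simp add: k_def)
  have "lift (A \<union> B) h k"
  proof (rule liftI)
    fix z assume "z \<in> A \<union> B"
    then show "k z \<in> carrier F"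
      using a(1) lift_closed[OF assms(3)] lift_closed[OF assms(4)] by (auto simp: k_def)
  next
    fix j assume j: "j \<in> J"
    have eq: "{z \<in> A \<union> B. h z \<in> U j} = {z \<in> A. h z \<in> U j} \<union> {z \<in> B. h z \<in> U j}"
      by blast
    have *: "closedin (top_of_set ({z \<in> A. h z \<in> U j} \<union> {z \<in> B. h z \<in> U j})) {z \<in> C. h z \<in> U j}"
      if "closedin (top_of_set (A \<union> B)) C" for C
    proof -
      from that obtain T where "closed T" "C = (A \<union> B) \<inter> T" by (auto simp: closedin_closed)
      then show ?thesis
        unfolding closedin_closed by (intro exI[of _ T]) auto
    qed
    have "locally_constant_on {z \<in> A. h z \<in> U j} (\<lambda>z. g z \<otimes> c j (h z))"
      by (rule liftD[OF assms(3) j]) auto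
    then have kA: "locally_constant_on {z \<in> A. h z \<in> U j} (\<lambda>z. k z \<otimes> c j (h z))"
      by (rule locally_constant_on_cong) (simp add: k_def)
    have "locally_constant_on {z \<in> B. h z \<in> U j} (\<lambda>z. a \<otimes> g' z \<otimes> c j (h z))"
      by (rule liftD[OF lift_mult_left[OF assms(4) a(1)] j]) auto
    then have "locally_constant_on {z \<in> B. h z \<in> U j} (\<lambda>z. k z \<otimes> c j (h z))"
      by (rule locally_constant_on_cong) (simp add: kB)
    with kA show "locally_constant_on {z \<in> A \<union> B. h z \<in> U j} (\<lambda>z. k z \<otimes> c j (h z))"
      unfolding eq by (rule locally_constant_on_Un[OF _ _ *[OF cl(1)] *[OF cl(2)]])
  qed
  then show ?thesis
    by blast
qed

text \<open>This is the section with coordinate one over \<open>U j\<close>; seen from another chart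
  it is a transition function along \<open>h\<close>.\<close>

lemma lift_in_chart:
  assumes "continuous_on D h" "j \<in> J" "h ` D \<subseteq> U j"
  shows "lift D h (\<lambda>z. inv (c j (h z)))"
proof (rule liftI)
  fix k assume k: "k \<in> J"
  show "locally_constant_on {z \<in> D. h z \<in> U k} (\<lambda>z. inv (c j (h z)) \<otimes> c k (h z))"
  proof (rule locally_constant_on_continuous_compose[OF transition[OF assms(2) k]])
    show "continuous_on {z \<in> D. h z \<in> U k} h"
      by (rule continuous_on_subset[OF assms(1)]) auto
  qed (use assms(3) in auto)
qed (use assms in auto)

text \<open>Rectangles small enough for one chart have lifts, and these are glued along segments,
  which are connected. Compactness enters as two runs of bisection (\<open>Bolzano\<close>): up a
  thin strip, then across the strips.\<close>

lemma lift_square_exists: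
  fixes h :: "real \<times> real \<Rightarrow> 'a"
  assumes h: "continuous_on ({0..1} \<times> {0..1}) h" "h ` ({0..1} \<times> {0..1}) \<subseteq> X"
  shows "\<exists>g. lift ({0..1} \<times> {0..1}) h g"
proof -
  \<comment> \<open>\<open>Bolzano\<close> asks about intervals around a point that may stick out of
    the unit interval, hence the clipping.\<close>
  define R where "R a b r s = ({a..b} \<inter> {0..1}) \<times> ({r..s} \<inter> {0..1::real})" for a b r s :: real
  have R: "R a b r s \<subseteq> {0..1} \<times> {0..1}" for a b r s
    by (auto simp: R_def)
  have closed_R: "closed (R a b r s)" for a b r s
    by (simp add: R_def closed_Times)
  have conn: "connected (R a b r s)" for a b r s
    by (simp add: R_def convex_connected convex_Times convex_Int)
  have glue: "\<exists>g. lift (A \<union> B) h g"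
    if "\<exists>g. lift A h g" "\<exists>g. lift B h g" "closed A" "closed B" "connected (A \<inter> B)"
      "A \<union> B \<subseteq> {0..1} \<times> {0..1}" for A B
  proof -
    from that obtain g g' where "lift A h g" "lift B h g'" by blast
    with that h show ?thesis
      by (intro lift_Un[of A B h g g'])
         (auto intro: continuous_on_subset closed_subset)
  qed
  have small: "\<exists>d>0. \<forall>a b r u. a \<le> x \<longrightarrow> x \<le> b \<longrightarrow> b - a < d \<longrightarrow> r \<le> y \<longrightarrow> y \<le> u \<longrightarrow> u - r < d \<longrightarrow>
      (\<exists>g. lift (R a b r u) h g)" if xy: "x \<in> {0..1}" "y \<in> {0..1}" for x y
  proof -
    have "(x, y) \<in> {0..1} \<times> {0..1}"
      using xy by auto
    from open_preimage_U[OF h this] obtain j N where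
      jN: "j \<in> J" "open N" "(x, y) \<in> N" "h ` ({0..1} \<times> {0..1} \<inter> N) \<subseteq> U j"
      by metis
    obtain A B where AB: "open A" "open B" "(x, y) \<in> A \<times> B" "A \<times> B \<subseteq> N"
      using jN(2,3) by (rule open_prod_elim)
    then have "x \<in> A" "y \<in> B"
      by simp_all
    obtain d e where de: "d > 0" "ball x d \<subseteq> A" "e > 0" "ball y e \<subseteq> B"
      using AB(1,2) \<open>x \<in> A\<close> \<open>y \<in> B\<close> unfolding open_contains_ball by metis
    show ?thesis
    proof (intro exI[of _ "min d e"] conjI allI impI)
      fix a b r u assume *: "a \<le> x" "x \<le> b" "b - a < min d e" "r \<le> y" "y \<le> u" "u - r < min d e"
      have "{a..b} \<subseteq> A"
        using * de(2) by (auto simp: subset_iff dist_real_def)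
      moreover have "{r..u} \<subseteq> B"
        using * de(4) by (auto simp: subset_iff dist_real_def)
      ultimately have "{a..b} \<times> {r..u} \<subseteq> N"
        using AB(4) by blast
      then have "R a b r u \<subseteq> {0..1} \<times> {0..1} \<inter> N"
        by (auto simp: R_def)
      then have "continuous_on (R a b r u) h" "h ` R a b r u \<subseteq> U j"
        using h(1) jN(4) by (blast intro: continuous_on_subset, blast)
      from lift_in_chart[OF this(1) jN(1) this(2)] show "\<exists>g. lift (R a b r u) h g"
        by blast
    qed (use de in auto)
  qed
  have strip: "\<exists>d>0. \<forall>a b. a \<le> x \<longrightarrow> x \<le> b \<longrightarrow> b - a < d \<longrightarrow> (\<exists>g. lift (R a b 0 1) h g)"
    if x: "x \<in> {0..1}" for x
  proof -
    \<comment> \<open>The width \<open>d\<close> is part of the predicate: gluing two rectangles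
      takes the smaller of their widths, so after the bisection one width serves the full
      height.\<close>
    define Q where "Q r u \<longleftrightarrow> (\<exists>d>0. \<forall>a b. a \<le> x \<longrightarrow> x \<le> b \<longrightarrow> b - a < d \<longrightarrow> (\<exists>g. lift (R a b r u) h g))" for r u
    have "0 \<le> (1::real)" by simp
    then have "Q 0 1"
    proof (induction rule: Bolzano)
      case (trans r u v)
      from trans(1,2) obtain d e where de: "d > 0" "e > 0"
         "\<And>a b. a \<le> x \<Longrightarrow> x \<le> b \<Longrightarrow> b - a < d \<Longrightarrow> \<exists>g. lift (R a b r u) h g"
         "\<And>a b. a \<le> x \<Longrightarrow> x \<le> b \<Longrightarrow> b - a < e \<Longrightarrow> \<exists>g. lift (R a b u v) h g"
        unfolding Q_def by metis
      show ?case
        unfolding Q_def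
      proof (intro exI[of _ "min d e"] conjI allI impI)
        fix a b assume *: "a \<le> x" "x \<le> b" "b - a < min d e"
        have "R a b r v = R a b r u \<union> R a b u v"
          using trans(3,4) by (auto simp: R_def)
        moreover have "R a b r u \<inter> R a b u v = R a b u u"
          using trans(3,4) by (auto simp: R_def)
        ultimately show "\<exists>g. lift (R a b r v) h g"
          using glue[of "R a b r u" "R a b u v"] de * R closed_R conn by simp
      qed (use de in auto)
    next
      case (local y)
      then have "y \<in> {0..1}" by simp
      from small[OF x this] show ?case
        unfolding Q_def by metis
    qed
    then show ?thesis
      by (simp only: Q_def)
  qed
  define Q where "Q a b \<longleftrightarrow> (\<exists>g. lift (R a b 0 1) h g)" for a b
  have "0 \<le> (1::real)" by simp
  then have "Q 0 1"
  proof (induction rule: Bolzano)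
    case (trans a b d)
    have "R a d 0 1 = R a b 0 1 \<union> R b d 0 1"
      using trans(3,4) by (auto simp: R_def)
    moreover have "R a b 0 1 \<inter> R b d 0 1 = R b b 0 1"
      using trans(3,4) by (auto simp: R_def)
    ultimately show ?case
      using glue[of "R a b 0 1" "R b d 0 1"] trans(1,2) R closed_R conn by (simp add: Q_def)
  next
    case (local x)
    then have "x \<in> {0..1}" by simp
    from strip[OF this] show ?case
      unfolding Q_def by metis
  qed
  then have "\<exists>g. lift (R 0 1 0 1) h g"
    by (simp only: Q_def)
  then show ?thesis
    by (simp add: R_def)
qed

text \<open>A path is treated as a square that is constant in the first coordinate, and the lift is
  restricted to one slice.\<close>

lemma lift_path_exists:
  assumes "path p" "path_image p \<subseteq> X"
  shows "\<exists>g. lift {0..1} p g"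
proof -
  have "\<exists>g. lift ({0..1} \<times> {0..1}) (\<lambda>z :: real \<times> real. p (snd z)) g"
  proof (rule lift_square_exists)
    show "continuous_on ({0..1} \<times> {0..1}) (\<lambda>z::real \<times> real. p (snd z))"
      using assms(1) unfolding path_def
      by (rule continuous_on_compose2) (auto intro: continuous_on_snd continuous_on_id)
  qed (use assms(2) in \<open>auto simp: path_image_def\<close>)
  then obtain g where "lift ({0..1} \<times> {0..1}) (\<lambda>z :: real \<times> real. p (snd z)) g" ..
  then have "lift {0..1} (\<lambda>t. p (snd (0 :: real, t))) (\<lambda>t. g (0, t))"
    by (rule lift_compose) (auto intro!: continuous_intros)
  then show ?thesis
    by (intro exI) simp
qed

section \<open>Holonomy of paths and its homotopy invariance\<close>

definition holonomy :: "(real \<Rightarrow> 'a) \<Rightarrow> 'b" where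
  "holonomy p = (let g = SOME g. lift {0..1} p g in inv (g 0) \<otimes> g 1)"

text \<open>By uniqueness two lifts differ by a left factor, which cancels in
  \<open>inv (g 0) \<otimes> g 1\<close>; so the lift chosen in the definition does not matter. The
  path need not be closed, because all fibres are copies of the same group \<open>F\<close>.\<close>

lemma holonomy_eq:
  assumes "path p" "path_image p \<subseteq> X" "lift {0..1} p g"
  shows "holonomy p = inv (g 0) \<otimes> g 1"
proof -
  define g' where "g' = (SOME g. lift {0..1} p g)"
  have g': "lift {0..1} p g'"
    unfolding g'_def by (rule someI[of _ g]) (fact assms(3))
  have c: "g 0 \<in> carrier F" "g 1 \<in> carrier F" "g' 0 \<in> carrier F" "g' 1 \<in> carrier F"
    using lift_closed[OF assms(3)] lift_closed[OF g'] by auto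
  have "g 0 \<otimes> inv (g' 0) = g 1 \<otimes> inv (g' 1)"
    using assms g' unfolding path_def path_image_def by (intro lift_unique[of "{0..1}" p]) auto
  then have "inv (g 0) \<otimes> (g 0 \<otimes> inv (g' 0)) \<otimes> g' 1 = inv (g 0) \<otimes> (g 1 \<otimes> inv (g' 1)) \<otimes> g' 1"
    by (rule arg_cong[where f = "\<lambda>u. inv (g 0) \<otimes> u \<otimes> g' 1"])
  moreover have "inv (g 0) \<otimes> (g 0 \<otimes> inv (g' 0)) = inv (g' 0)"
    using c by (simp add: m_assoc[symmetric])
  moreover have "inv (g 0) \<otimes> (g 1 \<otimes> inv (g' 1)) \<otimes> g' 1 = inv (g 0) \<otimes> g 1"
    using c by (simp add: m_assoc)
  ultimately have "inv (g' 0) \<otimes> g' 1 = inv (g 0) \<otimes> g 1"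
    by simp
  then show ?thesis
    by (simp add: holonomy_def g'_def Let_def)
qed

lemma holonomy_closed:
  assumes "path p" "path_image p \<subseteq> X"
  shows "holonomy p \<in> carrier F"
proof -
  from lift_path_exists[OF assms] obtain g where g: "lift {0..1} p g" ..
  then show ?thesis
    using holonomy_eq[OF assms g] lift_closed[OF g] by auto
qed

text \<open>One lift of the joined path restricts to lifts of both halves; they share the value at
  1/2, which cancels.\<close>

lemma holonomy_join:
  assumes "path p" "path_image p \<subseteq> X" "path q" "path_image q \<subseteq> X" "pathfinish p = pathstart q"
  shows "holonomy (p +++ q) = holonomy p \<otimes> holonomy q"
proof -
  have pq: "path (p +++ q)" "path_image (p +++ q) \<subseteq> X"
    using assms by (simp_all add: subset_path_image_join)
  from lift_path_exists[OF this] obtain g where g: "lift {0..1} (p +++ q) g" ..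
  have "lift {0..1} (\<lambda>t. (p +++ q) (t / 2)) (\<lambda>t. g (t / 2))"
    by (rule lift_compose[OF g]) (auto intro!: continuous_intros)
  then have p: "lift {0..1} p (\<lambda>t. g (t / 2))"
    by (rule lift_cong) (auto simp: joinpaths_def)
  have "lift {0..1} (\<lambda>t. (p +++ q) ((t + 1) / 2)) (\<lambda>t. g ((t + 1) / 2))"
    by (rule lift_compose[OF g]) (auto intro!: continuous_intros)
  then have q: "lift {0..1} q (\<lambda>t. g ((t + 1) / 2))"
  proof (rule lift_cong)
    fix t :: real assume "t \<in> {0..1}"
    then show "(p +++ q) ((t + 1) / 2) = q t"
      using assms(5)
      by (cases "t = 0") (auto simp: joinpaths_def pathstart_def pathfinish_def add_divide_distrib)
  qed
  have "g 0 \<in> carrier F" "g 1 \<in> carrier F" "g (1/2) \<in> carrier F"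
    using lift_closed[OF g] by auto
  then show ?thesis
    using holonomy_eq[OF pq g] holonomy_eq[OF assms(1,2) p] holonomy_eq[OF assms(3,4) q]
    by (simp add: m_assoc) (simp add: m_assoc[symmetric])
qed

lemma holonomy_reversepath:
  assumes "path p" "path_image p \<subseteq> X"
  shows "holonomy (reversepath p) = inv (holonomy p)"
proof -
  from lift_path_exists[OF assms] obtain g where g: "lift {0..1} p g" ..
  have "lift {0..1} (reversepath p) (\<lambda>t. g (1 - t))"
    unfolding reversepath_def
    by (rule lift_compose[OF g]) (auto intro!: continuous_intros)
  from holonomy_eq[OF _ _ this] holonomy_eq[OF assms g] show ?thesis
    using assms lift_closed[OF g] by (simp add: inv_mult_group)
qed

lemma holonomy_in_chart:
  assumes "path p" "j \<in> J" "path_image p \<subseteq> U j"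
  shows "holonomy p = c j (pathstart p) \<otimes> inv (c j (pathfinish p))"
proof -
  have X: "path_image p \<subseteq> X"
    using assms(3) openin_subset[OF openin_U[OF assms(2)]] by auto
  have "lift {0..1} p (\<lambda>z. inv (c j (p z)))"
    using assms by (intro lift_in_chart) (auto simp: path_def path_image_def)
  from holonomy_eq[OF assms(1) X this] show ?thesis
    using assms by (simp add: pathstart_def pathfinish_def path_image_def image_subset_iff)
qed

text \<open>A lift of the whole homotopy restricts to lifts of \<open>p\<close> and
  \<open>q\<close>. The end points stay fixed, so a single chart covers each of the other two sides
  and the lift is constant along them.\<close>

lemma holonomy_homotopic:
  assumes "homotopic_paths X p q"
  shows "holonomy p = holonomy q"
proof -
  from assms obtain h :: "real \<times> real \<Rightarrow> 'a" where h: "continuous_on ({0..1} \<times> {0..1}) h" "h ` ({0..1} \<times> {0..1}) \<subseteq> X"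
    "\<And>t. t \<in> {0..1} \<Longrightarrow> h (0, t) = p t" "\<And>t. t \<in> {0..1} \<Longrightarrow> h (1, t) = q t"
    "\<And>s. s \<in> {0..1} \<Longrightarrow> h (s, 0) = p 0" "\<And>s. s \<in> {0..1} \<Longrightarrow> h (s, 1) = p 1"
  proof -
    from assms obtain h :: "real \<times> real \<Rightarrow> 'a" where "continuous_on ({0..1} \<times> {0..1}) h" "h \<in> {0..1} \<times> {0..1} \<rightarrow> X"
      "\<forall>t\<in>{0..1}. h (0, t) = p t" "\<forall>t\<in>{0..1}. h (1, t) = q t"
      "\<forall>s\<in>{0..1}. pathstart (h \<circ> Pair s) = pathstart p \<and> pathfinish (h \<circ> Pair s) = pathfinish p"
      unfolding homotopic_paths by blast
    then show ?thesis
      by (intro that[of h]) (simp_all add: pathstart_def pathfinish_def image_subset_iff_funcset)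
  qed
  from lift_square_exists[OF h(1,2)] obtain g where g: "lift ({0..1} \<times> {0..1}) h g" ..
  have p: "path p" "path_image p \<subseteq> X" and q: "path q" "path_image q \<subseteq> X"
    using homotopic_paths_imp_path[OF assms] homotopic_paths_imp_subset[OF assms] by auto
  have side: "g (0, r) = g (1, r)" if r: "r \<in> {0..1}" and const: "\<And>s. s \<in> {0..1} \<Longrightarrow> h (s, r) = x"
    for r x
  proof -
    have "lift {0..1} (\<lambda>s. h (s, r)) (\<lambda>s. g (s, r))"
      by (rule lift_compose[OF g]) (use r in \<open>auto intro!: continuous_intros\<close>)
    then have g': "lift {0..1} (\<lambda>s. x) (\<lambda>s. g (s, r))"
      by (rule lift_cong) (rule const)
    have "x \<in> X"
      using h(2) const[of 0] r by auto
    then obtain j where j: "j \<in> J" "x \<in> U j"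
      using cover by blast
    have "locally_constant_on {0..1::real} (\<lambda>s. g (s, r) \<otimes> c j x)"
      by (rule liftD[OF g' j(1)]) (use j in auto)
    then have "g (0, r) \<otimes> c j x = g (1, r) \<otimes> c j x"
      by (rule locally_constant_on_connected[of "{0..1::real}" "\<lambda>s. g (s, r) \<otimes> c j x"]) auto
    then show ?thesis
      using j r lift_closed[OF g] by simp
  qed
  have "lift {0..1} p (\<lambda>t. g (0, t))"
    by (rule lift_cong, rule lift_compose[OF g]) (auto intro!: continuous_intros simp: h)
  moreover have "lift {0..1} q (\<lambda>t. g (1, t))"
    by (rule lift_cong, rule lift_compose[OF g]) (auto intro!: continuous_intros simp: h)
  ultimately show ?thesis
    using holonomy_eq[OF p] holonomy_eq[OF q] side[of 0] side[of 1] h by force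
qed

end

section \<open>Free quotients of the fundamental group\<close>

lemma free_group_Cons:
  assumes "(x, b) # w \<in> carrier (free_group S)"
  shows "x \<in> S" "w \<in> carrier (free_group S)" "(x, b) # w = [(x, b)] \<otimes>\<^bsub>free_group S\<^esub> w"
  using assms by (auto simp: free_group_def reduced_word_Cons push_letter_reduced)

lemma letter_in_free_group: "x \<in> S \<Longrightarrow> [(x, b)] \<in> carrier (free_group S)"
  by (simp add: free_group_def reduced_word_def)

lemma inv_letter:
  assumes "x \<in> S"
  shows "inv\<^bsub>free_group S\<^esub> [(x, True)] = [(x, False)]"
proof -
  interpret group "free_group S" by (rule group_free_group)
  show ?thesis
    by (rule inv_equality) (use assms in \<open>auto simp: free_group_def reduced_word_def\<close>)
qed

text \<open>Passing through \<open>W i\<close> from \<open>A i\<close> to \<open>B i\<close> and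
  returning through \<open>U0\<close> produces one letter. The labelling \<open>j\<close> is
  arbitrary, so the generators can be placed in any type; \<open>corank\<close> calls for this
  freedom.\<close>

lemma fundamental_group_epi_free_group:
  fixes X :: "'a::topological_space set" and j :: "'i \<Rightarrow> 'l"
  assumes "x0 \<in> X" "path_connected X"
    and U0: "openin (top_of_set X) U0" "path_connected U0"
    and W: "\<And>i. i \<in> I \<Longrightarrow> openin (top_of_set X) (W i)" "\<And>i. i \<in> I \<Longrightarrow> path_connected (W i)"
    and disj: "disjoint_family_on W I"
    and cov: "X \<subseteq> U0 \<union> \<Union>(W ` I)"
    and AB: "\<And>i. i \<in> I \<Longrightarrow> openin (top_of_set X) (A i)" "\<And>i. i \<in> I \<Longrightarrow> openin (top_of_set X) (B i)"
      "\<And>i. i \<in> I \<Longrightarrow> U0 \<inter> W i = A i \<union> B i" "\<And>i. i \<in> I \<Longrightarrow> A i \<inter> B i = {}"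
      "\<And>i. i \<in> I \<Longrightarrow> A i \<noteq> {}" "\<And>i. i \<in> I \<Longrightarrow> B i \<noteq> {}"
  shows "epi (fundamental_group X x0) (free_group (j ` I)) \<noteq> {}"
proof -
  let ?F = "free_group (j ` I)"
  \<comment> \<open>A path in \<open>W i\<close> from \<open>A i\<close> to \<open>B i\<close> gets the letter \<open>j i\<close> as its holonomy.\<close>
  define U where "U k = (case k of None \<Rightarrow> U0 | Some i \<Rightarrow> W i)" for k
  define c where "c k x = (case k of None \<Rightarrow> [] | Some i \<Rightarrow> if x \<in> A i then [(j i, True)] else [])" for k x
  define J where "J = insert None (Some ` I)"
  interpret group ?F by (rule group_free_group)
  have one: "\<one>\<^bsub>?F\<^esub> = []"
    by (simp add: free_group_def)
  have letter: "[(j i, b)] \<in> carrier ?F" if "i \<in> I" for i b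
    using that by (simp add: letter_in_free_group)
  have nil: "[] \<in> carrier ?F"
    using one_closed by (simp add: one)
  have c_in: "c k x \<in> carrier ?F" if "k \<in> J" for k x
    using that letter nil by (auto simp: c_def J_def)
  have cNone: "c None x = \<one>\<^bsub>?F\<^esub>" for x
    by (simp add: c_def one)
  \<comment> \<open>Both \<open>A i\<close> and \<open>B i\<close> are open, so membership in
    \<open>A i\<close> is locally constant on their disjoint union. This is what makes the
    transition functions locally constant.\<close>
  have locally_A: "locally_constant_on (U0 \<inter> W i) (\<lambda>x. x \<in> A i)" if i: "i \<in> I" for i
    unfolding locally_constant_on_def
  proof
    fix x assume x: "x \<in> U0 \<inter> W i"
    from AB(1,2)[OF i] obtain S T where ST: "open S" "A i = X \<inter> S" "open T" "B i = X \<inter> T"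
      by (auto simp: openin_open)
    have X: "U0 \<subseteq> X" using openin_subset[OF U0(1)] by simp
    show "\<exists>N. open N \<and> x \<in> N \<and> (\<forall>y\<in>N \<inter> (U0 \<inter> W i). (y \<in> A i) = (x \<in> A i))"
    proof (cases "x \<in> A i")
      case True
      then show ?thesis using ST X by (intro exI[of _ S]) auto
    next
      case False
      then have "x \<in> B i" using x AB(3)[OF i] by blast
      with False AB(4)[OF i] show ?thesis using ST X by (intro exI[of _ T]) auto
    qed
  qed
  interpret cocycle ?F X J U c
  proof unfold_locales
    show "openin (top_of_set X) (U k)" if "k \<in> J" for k
      using that U0 W by (auto simp: U_def J_def)
    show "X \<subseteq> \<Union> (U ` J)"
      using cov by (auto simp: U_def J_def)
    show "c k x \<in> carrier ?F" if "k \<in> J" for k x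
      using that by (rule c_in)
    fix k l assume kl: "k \<in> J" "l \<in> J"
    \<comment> \<open>Different \<open>W i\<close> are disjoint, so the only transitions with
      content are those between \<open>U0\<close> and some \<open>W i\<close>.\<close>
    consider "k = l" | i where "i \<in> I" "k = None" "l = Some i" | i where "i \<in> I" "l = None" "k = Some i"
      | i i' where "i \<in> I" "i' \<in> I" "i \<noteq> i'" "k = Some i" "l = Some i'"
      using kl unfolding J_def by blast
    then show "locally_constant_on (U k \<inter> U l) (\<lambda>x. inv\<^bsub>?F\<^esub> c k x \<otimes>\<^bsub>?F\<^esub> c l x)"
    proof cases
      case 1
      show ?thesis
        by (rule locally_constant_on_cong[OF locally_constant_on_const[of _ "\<one>\<^bsub>?F\<^esub>"]]) (use 1 kl c_in in simp)
    next
      case 2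
      have "locally_constant_on (U0 \<inter> W i) (\<lambda>x. if x \<in> A i then [(j i, True)] else [])"
        using locally_constant_on_compose2[OF locally_A locally_A, OF 2(1) 2(1), where k = "\<lambda>u v. if u then [(j i, True)] else []"]
        by simp
      then show ?thesis
        using 2 letter nil by (auto simp: U_def c_def one[symmetric] cong: if_cong elim!: locally_constant_on_cong)
    next
      case 3
      have "locally_constant_on (W i \<inter> U0) (\<lambda>x. inv\<^bsub>?F\<^esub> (if x \<in> A i then [(j i, True)] else []))"
        using locally_constant_on_compose2[OF locally_A locally_A, OF 3(1) 3(1), where k = "\<lambda>u v. inv\<^bsub>?F\<^esub> (if u then [(j i, True)] else [])"]
        by (simp add: Int_commute)
      then show ?thesis
        using 3 letter nil by (auto simp: U_def c_def one[symmetric] cong: if_cong elim!: locally_constant_on_cong)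
    next
      case 4
      then have "U k \<inter> U l = {}"
        using disj by (simp add: U_def disjoint_family_on_def)
      then show ?thesis by (simp add: locally_constant_on_def)
    qed
  qed
  \<comment> \<open>The base point may lie outside \<open>U0\<close>, so words are first realized by
    loops at an auxiliary point of \<open>U0\<close>.\<close>
  obtain x1 where x1: "x1 \<in> U0"
    using assms(1) cov AB(3,5) by (metis UN_E UnE Un_empty all_not_in_conv Int_emptyI in_mono)
  have sub: "U0 \<subseteq> X" "\<And>i. i \<in> I \<Longrightarrow> W i \<subseteq> X"
    using openin_subset[OF U0(1)] openin_subset[OF W(1)] by auto
  have gen: "\<exists>p. p \<in> loops_at X x1 \<and> holonomy p = [(j i, True)]" if i: "i \<in> I" for i
  proof -
    obtain a b where ab: "a \<in> A i" "b \<in> B i"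
      using AB(5,6)[OF i] by blast
    then have ab': "a \<in> U0" "b \<in> U0" "a \<in> W i" "b \<in> W i" "b \<notin> A i"
      using AB(3,4)[OF i] by auto
    obtain p where p: "path p" "path_image p \<subseteq> U0" "pathstart p = x1" "pathfinish p = a"
      using U0(2) x1 ab' unfolding path_connected_def by metis
    obtain q where q: "path q" "path_image q \<subseteq> W i" "pathstart q = a" "pathfinish q = b"
      using W(2)[OF i] ab' unfolding path_connected_def by metis
    obtain r where r: "path r" "path_image r \<subseteq> U0" "pathstart r = b" "pathfinish r = x1"
      using U0(2) x1 ab' unfolding path_connected_def by metis
    have X: "path_image p \<subseteq> X" "path_image q \<subseteq> X" "path_image r \<subseteq> X"
      using p(2) q(2) r(2) sub(1) sub(2)[OF i] by blast+
    have hp: "holonomy p = \<one>\<^bsub>?F\<^esub>"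
      using holonomy_in_chart[of p None] p by (simp add: J_def U_def cNone)
    have hr: "holonomy r = \<one>\<^bsub>?F\<^esub>"
      using holonomy_in_chart[of r None] r by (simp add: J_def U_def cNone)
    have "c (Some i) a = [(j i, True)]" "c (Some i) b = \<one>\<^bsub>?F\<^esub>"
      using ab ab' by (auto simp: c_def one)
    then have hq: "holonomy q = [(j i, True)]"
      using holonomy_in_chart[of q "Some i"] q i letter[OF i] by (simp add: J_def U_def)
    have qr: "path (q +++ r)" "path_image (q +++ r) \<subseteq> X"
      using q r X by (simp_all add: subset_path_image_join)
    have "holonomy (p +++ (q +++ r)) = [(j i, True)]"
      using p q r X qr letter[OF i] by (simp add: holonomy_join hp hq hr)
    moreover have "p +++ (q +++ r) \<in> loops_at X x1"
      using p q r X qr by (simp add: loops_at_def subset_path_image_join)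
    ultimately show ?thesis by blast
  qed
  \<comment> \<open>Induction on the reduced word, prepending one loop per letter; an inverse letter
    takes the reversed loop.\<close>
  have all_x1: "\<exists>p. p \<in> loops_at X x1 \<and> holonomy p = w" if "w \<in> carrier ?F" for w
    using that
  proof (induction w)
    case Nil
    have "(\<lambda>_. x1) \<in> loops_at X x1"
      using x1 sub by (auto simp: loops_at_def path_def path_image_def pathstart_def pathfinish_def)
    moreover have "holonomy (\<lambda>_. x1) = []"
      using holonomy_in_chart[of "\<lambda>_. x1" None] x1
      by (simp add: J_def U_def c_def path_def path_image_def one[symmetric])
    ultimately show ?case by blast
  next
    case (Cons l w)
    obtain y b where l: "l = (y, b)" by fastforce
    note w = free_group_Cons[OF Cons.prems[unfolded l]]
    from w(1) obtain i where i: "i \<in> I" "y = j i" by blast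
    obtain p where p: "p \<in> loops_at X x1" "holonomy p = w"
      using Cons.IH[OF w(2)] by blast
    obtain q' where q': "q' \<in> loops_at X x1" "holonomy q' = [(y, True)]"
      using gen[OF i(1)] unfolding i(2) by (elim exE conjE)
    define q where "q = (if b then q' else reversepath q')"
    have q: "q \<in> loops_at X x1"
      using q'(1) by (simp add: q_def loops_at_def)
    have hq: "holonomy q = [(y, b)]"
      using q' inv_letter[OF w(1)] by (simp add: q_def holonomy_reversepath loops_at_def)
    have "q +++ p \<in> loops_at X x1"
      using p q by (simp add: loops_at_def subset_path_image_join)
    moreover have "holonomy (q +++ p) = l # w"
      using p q hq l w(3) by (simp add: holonomy_join loops_at_def)
    ultimately show ?case by blast
  qed
  have all_x0: "\<exists>p. p \<in> loops_at X x0 \<and> holonomy p = w" if w: "w \<in> carrier ?F" for w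
  proof -
    obtain d where d: "path d" "path_image d \<subseteq> X" "pathstart d = x0" "pathfinish d = x1"
      using assms(1,2) x1 sub unfolding path_connected_def by blast
    let ?d = "holonomy d"
    have dF: "?d \<in> carrier ?F"
      using holonomy_closed d by blast
    \<comment> \<open>The word is conjugated by the holonomy of \<open>d\<close> in advance, so that
      moving the loop back to \<open>x0\<close> along \<open>d\<close> restores
      \<open>w\<close>.\<close>
    then obtain p where p: "p \<in> loops_at X x1" "holonomy p = inv\<^bsub>?F\<^esub> ?d \<otimes>\<^bsub>?F\<^esub> w \<otimes>\<^bsub>?F\<^esub> ?d"
      using all_x1[of "inv\<^bsub>?F\<^esub> ?d \<otimes>\<^bsub>?F\<^esub> w \<otimes>\<^bsub>?F\<^esub> ?d"] w by auto
    let ?e = "p +++ reversepath d"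
    have e: "path ?e" "path_image ?e \<subseteq> X"
      using p d by (simp_all add: loops_at_def subset_path_image_join)
    have "holonomy (d +++ ?e) = ?d \<otimes>\<^bsub>?F\<^esub> (inv\<^bsub>?F\<^esub> ?d \<otimes>\<^bsub>?F\<^esub> w \<otimes>\<^bsub>?F\<^esub> ?d \<otimes>\<^bsub>?F\<^esub> inv\<^bsub>?F\<^esub> ?d)"
      using p d e by (simp add: holonomy_join holonomy_reversepath loops_at_def)
    also have "\<dots> = w"
      using dF w by (simp add: m_assoc) (simp add: m_assoc[symmetric])
    finally have "holonomy (d +++ ?e) = w" .
    moreover have "d +++ ?e \<in> loops_at X x0"
      using p d e by (simp add: loops_at_def subset_path_image_join)
    ultimately show ?thesis by blast
  qed
  define \<phi> where "\<phi> K = holonomy (SOME p. p \<in> K)" for K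
  \<comment> \<open>A product of two classes is a union over all pairs of representatives, so
    \<open>\<phi>\<close> is evaluated on any set of paths with common holonomy, not just on a class
    given by one path.\<close>
  have \<phi>: "\<phi> K = w" if "p \<in> K" "\<And>p. p \<in> K \<Longrightarrow> holonomy p = w" for K p w
    unfolding \<phi>_def using that(2) someI[of "\<lambda>p. p \<in> K", OF that(1)] by blast
  have cls: "\<phi> (Collect (homotopic_paths X p)) = holonomy p" if "p \<in> loops_at X x0" for p
    using that holonomy_homotopic by (intro \<phi>[of p]) (auto simp: loops_at_def)
  have "\<phi> \<in> epi (fundamental_group X x0) ?F"
    unfolding epi_def hom_def
  proof (intro CollectI conjI ballI equalityI subsetI funcsetI)
    fix K assume "K \<in> carrier (fundamental_group X x0)"
    then show "\<phi> K \<in> carrier ?F"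
      using holonomy_closed by (auto simp: fundamental_group_def cls loops_at_def)
  next
    fix K L assume "K \<in> carrier (fundamental_group X x0)" "L \<in> carrier (fundamental_group X x0)"
    then obtain p q where pq: "p \<in> loops_at X x0" "q \<in> loops_at X x0"
      "K = Collect (homotopic_paths X p)" "L = Collect (homotopic_paths X q)"
      by (auto simp: fundamental_group_def)
    have "\<phi> (K \<otimes>\<^bsub>fundamental_group X x0\<^esub> L) = holonomy p \<otimes>\<^bsub>?F\<^esub> holonomy q"
    proof (rule \<phi>)
      have "homotopic_paths X p p" "homotopic_paths X q q"
        "homotopic_paths X (p +++ q) (p +++ q)"
        using pq by (simp_all add: loops_at_def subset_path_image_join)
      then show "p +++ q \<in> K \<otimes>\<^bsub>fundamental_group X x0\<^esub> L"
        unfolding fundamental_group_def pq(3,4) by (auto simp del: homotopic_paths_refl)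
    next
      fix r assume "r \<in> K \<otimes>\<^bsub>fundamental_group X x0\<^esub> L"
      then obtain p' q' where h: "homotopic_paths X p p'" "homotopic_paths X q q'" "homotopic_paths X (p' +++ q') r"
        unfolding fundamental_group_def pq(3,4) by auto
      have p'q': "path p'" "path q'" "path_image p' \<subseteq> X" "path_image q' \<subseteq> X" "pathfinish p' = pathstart q'"
        using homotopic_paths_imp_path[OF h(1)] homotopic_paths_imp_path[OF h(2)]
          homotopic_paths_imp_subset[OF h(1)] homotopic_paths_imp_subset[OF h(2)]
          homotopic_paths_imp_pathfinish[OF h(1)] homotopic_paths_imp_pathstart[OF h(2)] pq(1,2)
        by (simp_all add: loops_at_def)
      have "holonomy r = holonomy (p' +++ q')"
        using holonomy_homotopic[OF h(3)] by simp
      also have "\<dots> = holonomy p' \<otimes>\<^bsub>?F\<^esub> holonomy q'"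
        using p'q' by (simp add: holonomy_join)
      finally show "holonomy r = holonomy p \<otimes>\<^bsub>?F\<^esub> holonomy q"
        using holonomy_homotopic[OF h(1)] holonomy_homotopic[OF h(2)] by simp
    qed
    then show "\<phi> (K \<otimes>\<^bsub>fundamental_group X x0\<^esub> L) = \<phi> K \<otimes>\<^bsub>?F\<^esub> \<phi> L"
      using pq cls by simp
  next
    fix w assume "w \<in> \<phi> ` carrier (fundamental_group X x0)"
    then show "w \<in> carrier ?F"
      using holonomy_closed by (auto simp: fundamental_group_def cls loops_at_def)
  next
    fix w assume "w \<in> carrier ?F"
    then obtain p where "p \<in> loops_at X x0" "holonomy p = w"
      using all_x0 by blast
    then show "w \<in> \<phi> ` carrier (fundamental_group X x0)"
      by (intro image_eqI[of _ _ "Collect (homotopic_paths X p)"]) (auto simp: fundamental_group_def cls)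
  qed
  then show ?thesis by blast
qed

text \<open>\<open>corank\<close> admits only generators from the element type of \<open>G\<close>.
  Chosen preimages \<open>j i\<close> of the letters under an epimorphism onto
  \<open>free_group I\<close> are distinct, so they form such a set of the right size. Since
  \<open>j\<close> depends on that epimorphism, the assumption has to cover every labelling.\<close>

lemma card_le_corank:
  assumes "finite I" and epi: "\<And>j :: 'i \<Rightarrow> 'a. epi G (free_group (j ` I)) \<noteq> {}"
    "epi G (free_group I) \<noteq> {}"
  shows "enat (card I) \<le> corank (G :: ('a, 'm) monoid_scheme)"
proof -
  from epi(2) obtain \<psi> where \<psi>: "\<psi> \<in> epi G (free_group I)" by blast
  define j where "j i = (SOME g. g \<in> carrier G \<and> \<psi> g = [(i, True)])" for i
  have j: "\<psi> (j i) = [(i, True)]" if "i \<in> I" for i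
  proof -
    have "[(i, True)] \<in> \<psi> ` carrier G"
      using \<psi> letter_in_free_group[OF that] by (auto simp: epi_def)
    then have "\<exists>g. g \<in> carrier G \<and> \<psi> g = [(i, True)]" by force
    from someI_ex[OF this] show ?thesis by (simp add: j_def)
  qed
  have "inj_on j I"
  proof (rule inj_onI)
    fix x y assume xy: "x \<in> I" "y \<in> I" "j x = j y"
    then have "[(x, True)] = [(y, True)]" using j by metis
    then show "x = y" by simp
  qed
  then have "enat (card I) = (if finite (j ` I) then enat (card (j ` I)) else \<infinity>)"
    using assms(1) by (simp add: card_image)
  also have "\<dots> \<le> corank G"
    unfolding corank_def by (rule SUP_upper) (use epi(1) in blast)
  finally show ?thesis .
qed

section \<open>Ranks of abelian groups\<close>

text \<open>
  Relations are required for families rather than sets, since preimages or images of the members of a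
  family under a homomorphism need not be distinct.
\<close>

definition rank_at_most :: "('a, 'm) monoid_scheme \<Rightarrow> nat \<Rightarrow> bool" where
  "rank_at_most G n \<longleftrightarrow>
     (\<forall>b. b \<in> {..n} \<rightarrow> carrier G \<longrightarrow>
        (\<exists>c :: nat \<Rightarrow> int. (\<exists>i\<le>n. c i \<noteq> 0) \<and> finprod G (\<lambda>i. b i [^]\<^bsub>G\<^esub> c i) {..n} = \<one>\<^bsub>G\<^esub>))"

lemma abelian_rank_le:
  assumes "comm_group G" "rank_at_most G n"
  shows "abelian_rank G \<le> enat n"
  unfolding abelian_rank_def
proof (rule SUP_least)
  interpret comm_group G by fact
  fix B assume "B \<in> {B. finite B \<and> B \<subseteq> carrier G \<and> int_independent G B}"
  then have B: "finite B" "B \<subseteq> carrier G" "int_independent G B" by auto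
  have "card B \<le> n"
  proof (rule ccontr)
    assume "\<not> card B \<le> n"
    then have "Suc n \<le> card B" by simp
    then obtain B' where B': "B' \<subseteq> B" "card B' = Suc n" "finite B'"
      using obtain_subset_with_card_n by metis
    obtain e where e: "bij_betw e {0..<Suc n} B'"
      using ex_bij_betw_nat_finite[OF B'(3)] B'(2) by auto
    then have inj: "inj_on e {..n}" and img: "e ` {..n} = B'"
      by (auto simp: bij_betw_def atLeast0LessThan lessThan_Suc_atMost)
    have eG: "e \<in> {..n} \<rightarrow> carrier G"
      using img B(2) B'(1) by blast
    with assms(2) obtain c :: "nat \<Rightarrow> int" where
      c: "\<exists>i\<le>n. c i \<noteq> 0" "finprod G (\<lambda>i. e i [^]\<^bsub>G\<^esub> c i) {..n} = \<one>\<^bsub>G\<^esub>"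
      unfolding rank_at_most_def by blast
    \<comment> \<open>The relation among \<open>n + 1\<close> members is extended to all of
      \<open>B\<close> by zero coefficients.\<close>
    define d where "d x = (if x \<in> B' then c (inv_into {..n} e x) else 0)" for x
    have de: "d (e i) = c i" if "i \<le> n" for i
      using that img inj by (auto simp: d_def)
    have "finprod G (\<lambda>x. x [^]\<^bsub>G\<^esub> d x) B = finprod G (\<lambda>x. x [^]\<^bsub>G\<^esub> d x) (e ` {..n})"
      using B B' img by (intro finprod_mono_neutral_cong_right) (auto simp: d_def)
    also have "\<dots> = finprod G (\<lambda>i. e i [^]\<^bsub>G\<^esub> d (e i)) {..n}"
      using inj eG by (intro finprod_reindex) auto
    also have "\<dots> = finprod G (\<lambda>i. e i [^]\<^bsub>G\<^esub> c i) {..n}"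
      using eG de by (intro finprod_cong') auto
    finally have "\<forall>x\<in>B. d x = 0"
      using B(3) c(2) unfolding int_independent_def by simp
    moreover obtain i where "i \<le> n" "c i \<noteq> 0" using c(1) by blast
    ultimately show False
      using de[of i] img B'(1) by auto
  qed
  then show "enat (card B) \<le> enat n" by simp
qed

lemma trivial_group_rank: "trivial_group G \<Longrightarrow> rank_at_most G 0"
  unfolding rank_at_most_def
proof (intro allI impI)
  fix b assume G: "trivial_group G" and b: "b \<in> {..0::nat} \<rightarrow> carrier G"
  interpret group G using G by (simp add: trivial_group_def)
  have "carrier G = {\<one>\<^bsub>G\<^esub>}" using G by (simp add: trivial_group_def)
  with b have "b 0 = \<one>\<^bsub>G\<^esub>" by auto
  moreover have "finprod G (\<lambda>i. b i [^]\<^bsub>G\<^esub> (1::int)) {0::nat} = \<one>\<^bsub>G\<^esub>"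
  proof (cases "comm_monoid G")
    case True
    then interpret comm_monoid G .
    show ?thesis using \<open>b 0 = _\<close> by simp
  next
    case False
    interpret comm_monoid G
      using \<open>carrier G = _\<close> by unfold_locales auto
    show ?thesis using \<open>b 0 = _\<close> by simp
  qed
  ultimately show "\<exists>c :: nat \<Rightarrow> int. (\<exists>i\<le>0. c i \<noteq> 0) \<and> finprod G (\<lambda>i. b i [^]\<^bsub>G\<^esub> c i) {..0} = \<one>\<^bsub>G\<^esub>"
    by (intro exI[of _ "\<lambda>_. 1"]) (auto simp: atMost_0)
qed

lemma hom_finprod_int_pow:
  assumes "comm_group G" "comm_group H" "f \<in> hom G H" "finite A" "a \<in> A \<rightarrow> carrier G"
  shows "f (finprod G (\<lambda>i. a i [^]\<^bsub>G\<^esub> (c i :: int)) A) = finprod H (\<lambda>i. f (a i) [^]\<^bsub>H\<^esub> c i) A"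
  using assms(4,5)
proof (induction A)
  interpret G: comm_group G by fact
  interpret H: comm_group H by fact
  interpret group_hom G H f by unfold_locales fact
  {
    case empty
    then show ?case by simp
  next
    case (insert x A)
    then have "a x \<in> carrier G" "a \<in> A \<rightarrow> carrier G" by auto
    with insert show ?case
      by (subst G.finprod_insert H.finprod_insert; auto simp: hom_int_pow Pi_iff)+
  }
qed

lemma rank_at_most_epi:
  assumes "comm_group G" "comm_group H" "f \<in> epi G H" "rank_at_most G n"
  shows "rank_at_most H n"
  unfolding rank_at_most_def
proof (intro allI impI)
  interpret G: comm_group G by fact
  interpret H: comm_group H by fact
  have f: "f \<in> hom G H" "f ` carrier G = carrier H" using assms(3) by (auto simp: epi_def)
  interpret group_hom G H f
    by (rule group_hom.intro[OF G.group_axioms H.group_axioms group_hom_axioms.intro[OF f(1)]])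
  fix b assume b: "b \<in> {..n} \<rightarrow> carrier H"
  have "\<exists>x. x \<in> carrier G \<and> f x = b i" if "i \<in> {..n}" for i
  proof -
    have "b i \<in> f ` carrier G"
      unfolding f(2) using b that by (rule funcset_mem)
    then show ?thesis by (elim imageE) auto
  qed
  then obtain a where a: "\<And>i. i \<in> {..n} \<Longrightarrow> a i \<in> carrier G \<and> f (a i) = b i"
    by metis
  then have aG: "a \<in> {..n} \<rightarrow> carrier G" by auto
  with assms(4) obtain c :: "nat \<Rightarrow> int" where
    c: "\<exists>i\<le>n. c i \<noteq> 0" "finprod G (\<lambda>i. a i [^]\<^bsub>G\<^esub> c i) {..n} = \<one>\<^bsub>G\<^esub>"
    unfolding rank_at_most_def by blast
  have "finprod H (\<lambda>i. b i [^]\<^bsub>H\<^esub> c i) {..n} = finprod H (\<lambda>i. f (a i) [^]\<^bsub>H\<^esub> c i) {..n}"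
    using a funcset_mem[OF b] by (intro H.finprod_cong') auto
  also have "\<dots> = f (finprod G (\<lambda>i. a i [^]\<^bsub>G\<^esub> c i) {..n})"
    using hom_finprod_int_pow[OF assms(1,2) f(1) _ aG] by simp
  finally show "\<exists>c :: nat \<Rightarrow> int. (\<exists>i\<le>n. c i \<noteq> 0) \<and> finprod H (\<lambda>i. b i [^]\<^bsub>H\<^esub> c i) {..n} = \<one>\<^bsub>H\<^esub>"
    using c by auto
qed

text \<open>A homomorphism to the integers costs at most one dimension. If all
  \<open>k (b i)\<close> vanish, a relation among the first \<open>n + 1\<close> members comes from
  \<open>G\<close>; otherwise some \<open>b m\<close> with nonzero image is a pivot, and the other
  \<open>n + 1\<close> members are corrected into the kernel.\<close>

lemma rank_at_most_extension:
  assumes G: "comm_group G" and H: "comm_group H" and f: "f \<in> hom G H" and k: "k \<in> hom H integer_group"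
    and ker: "\<And>y. y \<in> carrier H \<Longrightarrow> k y = 0 \<Longrightarrow> y \<in> f ` carrier G"
    and rank: "rank_at_most G n"
  shows "rank_at_most H (Suc n)"
  unfolding rank_at_most_def
proof (intro allI impI)
  interpret G: comm_group G by fact
  interpret H: comm_group H by fact
  interpret k: group_hom H integer_group k
    by (rule group_hom.intro[OF H.group_axioms group_integer_group group_hom_axioms.intro[OF k]])
  fix b assume b: "b \<in> {..Suc n} \<rightarrow> carrier H"
  have lift: "\<exists>c :: nat \<Rightarrow> int. (\<exists>i\<le>n. c i \<noteq> 0) \<and> finprod H (\<lambda>i. d i [^]\<^bsub>H\<^esub> c i) {..n} = \<one>\<^bsub>H\<^esub>"
    if d: "\<And>i. i \<le> n \<Longrightarrow> d i \<in> carrier H" "\<And>i. i \<le> n \<Longrightarrow> k (d i) = 0" for d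
  proof -
    have "\<exists>x. x \<in> carrier G \<and> f x = d i" if "i \<in> {..n}" for i
    proof -
      have "d i \<in> f ` carrier G"
        using that d by (intro ker) auto
      then show ?thesis by (elim imageE) auto
    qed
    then obtain a where a: "\<And>i. i \<in> {..n} \<Longrightarrow> a i \<in> carrier G \<and> f (a i) = d i"
      by metis
    then have aG: "a \<in> {..n} \<rightarrow> carrier G" by auto
    with rank obtain c :: "nat \<Rightarrow> int" where
      c: "\<exists>i\<le>n. c i \<noteq> 0" "finprod G (\<lambda>i. a i [^]\<^bsub>G\<^esub> c i) {..n} = \<one>\<^bsub>G\<^esub>"
      unfolding rank_at_most_def by blast
    have "finprod H (\<lambda>i. d i [^]\<^bsub>H\<^esub> c i) {..n} = finprod H (\<lambda>i. f (a i) [^]\<^bsub>H\<^esub> c i) {..n}"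
      using a d by (intro H.finprod_cong') auto
    also have "\<dots> = f (finprod G (\<lambda>i. a i [^]\<^bsub>G\<^esub> c i) {..n})"
      using hom_finprod_int_pow[OF G H f _ aG] by simp
    also have "\<dots> = \<one>\<^bsub>H\<^esub>"
      using c(2) f G.group_axioms H.group_axioms by (simp add: hom_one)
    finally show ?thesis using c by auto
  qed
  show "\<exists>c :: nat \<Rightarrow> int. (\<exists>i\<le>Suc n. c i \<noteq> 0) \<and> finprod H (\<lambda>i. b i [^]\<^bsub>H\<^esub> c i) {..Suc n} = \<one>\<^bsub>H\<^esub>"
  proof (cases "\<forall>i\<le>Suc n. k (b i) = 0")
    case True
    with lift[of b] b obtain c :: "nat \<Rightarrow> int" where
      c: "\<exists>i\<le>n. c i \<noteq> 0" "finprod H (\<lambda>i. b i [^]\<^bsub>H\<^esub> c i) {..n} = \<one>\<^bsub>H\<^esub>"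
      by (auto simp: Pi_iff)
    define c' where "c' i = (if i \<le> n then c i else 0)" for i
    have "finprod H (\<lambda>i. b i [^]\<^bsub>H\<^esub> c' i) {..n} = finprod H (\<lambda>i. b i [^]\<^bsub>H\<^esub> c i) {..n}"
      using funcset_mem[OF b] by (intro H.finprod_cong') (auto simp: c'_def)
    then have "finprod H (\<lambda>i. b i [^]\<^bsub>H\<^esub> c' i) {..Suc n} = \<one>\<^bsub>H\<^esub>"
      using funcset_mem[OF b] c(2) by (subst H.finprod_Suc) (auto simp: c'_def)
    moreover have "\<exists>i\<le>Suc n. c' i \<noteq> 0"
      using c(1) unfolding c'_def by (metis le_SucI)
    ultimately show ?thesis by blast
  next
    case False
    then obtain m where m: "m \<le> Suc n" "k (b m) \<noteq> 0" by blast
    define z where "z i = k (b i)" for i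
    define e where "e i = (if i < m then i else Suc i)" for i
    have e: "inj_on e {..n}" "e ` {..n} = {..Suc n} - {m}"
    proof -
      show "inj_on e {..n}" by (auto simp: inj_on_def e_def split: if_splits)
      show "e ` {..n} = {..Suc n} - {m}"
      proof (intro equalityI subsetI)
        fix i assume i: "i \<in> {..Suc n} - {m}"
        show "i \<in> e ` {..n}"
        proof (cases "i < m")
          case True
          then show ?thesis using m by (intro image_eqI[of _ _ i]) (auto simp: e_def)
        next
          case False
          then show ?thesis using i by (intro image_eqI[of _ _ "i - 1"]) (auto simp: e_def)
        qed
      qed (use m in \<open>auto simp: e_def split: if_splits\<close>)
    qed
    have bH: "b i \<in> carrier H" if "i \<le> Suc n" for i using b that by auto
    have bm: "b m \<in> carrier H" using bH m by simp
    have be: "b (e i) \<in> carrier H" if "i \<le> n" for i using that by (intro bH) (auto simp: e_def)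
    \<comment> \<open>Elimination without division: \<open>b (e i)\<close> is first raised to the
      power \<open>z m\<close>, and then a power of the pivot cancels its image under
      \<open>k\<close>.\<close>
    define d where "d i = b (e i) [^]\<^bsub>H\<^esub> z m \<otimes>\<^bsub>H\<^esub> b m [^]\<^bsub>H\<^esub> (- z (e i))" for i
    have "d i \<in> carrier H" "k (d i) = 0" if "i \<le> n" for i
    proof -
      have "k (d i) = k (b (e i)) [^]\<^bsub>integer_group\<^esub> z m \<otimes>\<^bsub>integer_group\<^esub> k (b m) [^]\<^bsub>integer_group\<^esub> (- z (e i))"
        unfolding d_def using be[OF that] bm by (simp only: k.hom_mult k.hom_int_pow H.int_pow_closed)
      then show "k (d i) = 0"
        by (simp add: z_def)
      show "d i \<in> carrier H"
        unfolding d_def using be[OF that] bm by (intro H.m_closed H.int_pow_closed)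
    qed
    then have "\<exists>c :: nat \<Rightarrow> int. (\<exists>i\<le>n. c i \<noteq> 0) \<and> finprod H (\<lambda>i. d i [^]\<^bsub>H\<^esub> c i) {..n} = \<one>\<^bsub>H\<^esub>"
      by (rule lift)
    then obtain c :: "nat \<Rightarrow> int" where
      "(\<exists>i\<le>n. c i \<noteq> 0) \<and> finprod H (\<lambda>i. d i [^]\<^bsub>H\<^esub> c i) {..n} = \<one>\<^bsub>H\<^esub>"
      by (rule exE)
    note c = conjunct1[OF this] conjunct2[OF this]
    \<comment> \<open>Expanding a relation among the \<open>d i\<close> gives these coefficients for
      the \<open>b j\<close>. Off the pivot they are the \<open>c i\<close> multiplied by
      \<open>z m\<close>, which is nonzero, so the relation stays nontrivial.\<close>
    define C where "C j = (if j = m then - (\<Sum>i\<le>n. z (e i) * c i) else z m * c (inv_into {..n} e j))" for j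
    have em: "e i \<noteq> m" for i by (auto simp: e_def)
    have Ce: "C (e i) = z m * c i" if "i \<le> n" for i
      using that e(1) em by (simp add: C_def)
    have pow_sum: "finprod H (\<lambda>i. b m [^]\<^bsub>H\<^esub> (g i :: int)) {..n} = b m [^]\<^bsub>H\<^esub> (\<Sum>i\<le>n. g i)" for g
    proof (induction n)
      case (Suc n)
      then show ?case using bm by (subst H.finprod_Suc) (auto simp: H.int_pow_mult H.m_comm)
    qed (use bm in simp)
    have "finprod H (\<lambda>i. b i [^]\<^bsub>H\<^esub> C i) {..Suc n} = finprod H (\<lambda>i. b i [^]\<^bsub>H\<^esub> C i) (insert m (e ` {..n}))"
      using m by (simp add: e(2) insert_absorb)
    also have "\<dots> = b m [^]\<^bsub>H\<^esub> C m \<otimes>\<^bsub>H\<^esub> finprod H (\<lambda>i. b i [^]\<^bsub>H\<^esub> C i) (e ` {..n})"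
      using em bm be by (intro H.finprod_insert) auto
    also have "finprod H (\<lambda>i. b i [^]\<^bsub>H\<^esub> C i) (e ` {..n}) = finprod H (\<lambda>i. b (e i) [^]\<^bsub>H\<^esub> C (e i)) {..n}"
      using be e(1) by (intro H.finprod_reindex) auto
    also have "\<dots> = finprod H (\<lambda>i. b (e i) [^]\<^bsub>H\<^esub> (z m * c i)) {..n}"
      using be Ce by (intro H.finprod_cong') auto
    also have "b m [^]\<^bsub>H\<^esub> C m = finprod H (\<lambda>i. b m [^]\<^bsub>H\<^esub> (- (z (e i) * c i))) {..n}"
      unfolding pow_sum by (simp add: C_def sum_negf)
    also have "\<dots> \<otimes>\<^bsub>H\<^esub> finprod H (\<lambda>i. b (e i) [^]\<^bsub>H\<^esub> (z m * c i)) {..n} =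
        finprod H (\<lambda>i. b m [^]\<^bsub>H\<^esub> (- (z (e i) * c i)) \<otimes>\<^bsub>H\<^esub> b (e i) [^]\<^bsub>H\<^esub> (z m * c i)) {..n}"
      using bm be by (intro H.finprod_multf[symmetric]) auto
    also have "\<dots> = finprod H (\<lambda>i. d i [^]\<^bsub>H\<^esub> c i) {..n}"
    proof (rule H.finprod_cong')
      fix i assume "i \<in> {..n}"
      then have "b (e i) \<in> carrier H" using be by simp
      then show "b m [^]\<^bsub>H\<^esub> (- (z (e i) * c i)) \<otimes>\<^bsub>H\<^esub> b (e i) [^]\<^bsub>H\<^esub> (z m * c i) = d i [^]\<^bsub>H\<^esub> c i"
        using bm by (simp add: d_def H.int_pow_distrib H.int_pow_pow H.m_comm)
    qed (use be bm in \<open>auto simp: d_def\<close>)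
    finally have "finprod H (\<lambda>i. b i [^]\<^bsub>H\<^esub> C i) {..Suc n} = \<one>\<^bsub>H\<^esub>"
      using c(2) by simp
    moreover obtain i where "i \<le> n" "c i \<noteq> 0" using c(1) by blast
    then have "C (e i) \<noteq> 0" "e i \<le> Suc n"
      using Ce m by (auto simp: z_def e_def)
    ultimately show ?thesis by blast
  qed
qed

section \<open>Homology of a space with an edge\<close>

abbreviation open_unit :: "real topology" where
  "open_unit \<equiv> top_of_set {0<..<1}"

abbreviation punctured :: "real set" where
  "punctured \<equiv> {0<..<1} - {1/2}"

lemma one_in_homology_group: "\<one>\<^bsub>relative_homology_group p X S\<^esub> \<in> carrier (relative_homology_group p X S)"
  by (rule monoid.one_closed[OF group.is_monoid[OF group_relative_homology_group]])

lemma contractible_open_unit: "contractible_space open_unit"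
  by (simp add: convex_imp_contractible)

section \<open>The open interval relative to the complement of its midpoint\<close>

lemma trivial_homology_open_unit: "trivial_group (homology_group 1 open_unit)"
  using trivial_reduced_homology_group_contractible_space[OF contractible_open_unit, of 1]
  by (simp add: un_reduced_homology_group)

text \<open>As the interval is contractible, the relative group is the reduced \<open>H_0\<close> of
  the punctured interval. Each half contracts to one point, 1/4 or 3/4, and the reduced
  \<open>H_0\<close> of two points is the \<open>H_0\<close> of one.\<close>

lemma relative_homology_punctured: "relative_homology_group 1 open_unit punctured \<cong> integer_group"
proof -
  let ?f = "\<lambda>x::real. if x < 1/2 then 1/4 else 3/4 :: real"
  have cont: "continuous_on punctured ?f"
  proof -
    have eq: "punctured = {0<..<1/2} \<union> {1/2<..<1::real}" by auto
    have 1: "continuous_on {0<..<1/2} ?f"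
      by (rule continuous_on_eq[of _ "\<lambda>_. 1/4"]) auto
    have 2: "continuous_on {1/2<..<1} ?f"
      by (rule continuous_on_eq[of _ "\<lambda>_. 3/4"]) auto
    show ?thesis
      unfolding eq by (rule continuous_on_open_Un) (use 1 2 in auto)
  qed
  have cont': "continuous_on {1/4,3/4} ?f"
    by (rule continuous_on_subset[OF cont]) auto
  have "homotopic_with_canon (\<lambda>_. True) punctured punctured ?f id"
  proof (rule homotopic_with_linear)
    fix x :: real assume x: "x \<in> punctured"
    show "closed_segment (?f x) (id x) \<subseteq> punctured"
    proof (cases "x < 1/2")
      case True
      then have "closed_segment (?f x) (id x) \<subseteq> {0<..<1/2}"
        using x by (intro closed_segment_subset) auto
      then show ?thesis by auto
    next
      case False
      then have "closed_segment (?f x) (id x) \<subseteq> {1/2<..<1}"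
        using x by (intro closed_segment_subset) auto
      then show ?thesis by auto
    qed
  qed (use cont in \<open>auto intro: continuous_on_id\<close>)
  moreover have "homotopic_with (\<lambda>_. True) (top_of_set {1/4,3/4}) (top_of_set {1/4,3/4}) ?f id"
  proof (rule homotopic_with_equal)
    show "continuous_map (top_of_set {1/4,3/4}) (top_of_set {1/4,3/4}) ?f"
      using cont' by auto
  qed auto
  ultimately have eqv: "top_of_set punctured homotopy_equivalent_space top_of_set {1/4,3/4::real}"
    unfolding homotopy_equivalent_space_def using cont
    by (intro exI[of _ ?f] exI[of _ id]) (auto simp: comp_def id_def[symmetric])
  have "1/4 \<in> topspace open_unit \<inter> punctured"
    by simp
  then have "relative_homology_group 1 open_unit punctured \<cong> reduced_homology_group (1 - 1) (subtopology open_unit punctured)"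
    by (intro isomorphic_group_relative_homology_of_contractible[OF contractible_open_unit]) blast
  also have "subtopology open_unit punctured = top_of_set punctured"
    by (simp add: subtopology_subtopology Int_absorb1)
  also have "reduced_homology_group (1 - 1) (top_of_set punctured) \<cong> reduced_homology_group 0 (top_of_set {1/4,3/4::real})"
    using homotopy_equivalent_space_imp_isomorphic_reduced_homology_groups[OF eqv] by simp
  also have "\<dots> \<cong> homology_group 0 (top_of_set {1/4::real})"
    by (rule reduced_homology_group_pair) (auto intro: Hausdorff_imp_t1_space Hausdorff_space_euclidean)
  also have "\<dots> \<cong> integer_group"
    by (rule isomorphic_integer_zeroth_homology_group) auto
  finally show ?thesis .
qed

text \<open>Being the identity near 1/2 and constant on the outer quarters, it turns the coordinate
  of an edge into a function that extends continuously by 1/4 and 3/4 beyond the edge.\<close>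

definition clamp_middle :: "real \<Rightarrow> real" where
  "clamp_middle x = max (1/4) (min (3/4) x)"

lemma continuous_clamp_middle: "continuous_on A clamp_middle"
  unfolding clamp_middle_def by (intro continuous_intros)

text \<open>The straight-line homotopy to the identity respects the pair: it keeps each half of the
  interval inside itself.\<close>

lemma hom_induced_clamp_middle:
  assumes "c \<in> carrier (relative_homology_group p open_unit punctured)"
  shows "hom_induced p open_unit punctured open_unit punctured clamp_middle c = c"
proof -
  let ?h = "\<lambda>z::real \<times> real. (1 - fst z) * clamp_middle (snd z) + fst z * snd z"
  have side: "(1 - t) * clamp_middle x + t * x \<in> {0<..<1/2}" if "0 \<le> t" "t \<le> 1" "0 < x" "x < 1/2" for t x
  proof -
    have "closed_segment (clamp_middle x) x \<subseteq> {0<..<1/2}"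
      using that by (intro closed_segment_subset) (auto simp: clamp_middle_def)
    then show ?thesis
      using that by (auto simp: closed_segment_def subset_iff)
  qed
  have side': "(1 - t) * clamp_middle x + t * x \<in> {1/2<..<1}" if "0 \<le> t" "t \<le> 1" "1/2 < x" "x < 1" for t x
  proof -
    have "closed_segment (clamp_middle x) x \<subseteq> {1/2<..<1}"
      using that by (intro closed_segment_subset) (auto simp: clamp_middle_def)
    then show ?thesis
      using that by (auto simp: closed_segment_def subset_iff)
  qed
  have mid: "(1 - t) * clamp_middle (1/2) + t * (1/2) = 1/2" for t
    by (simp add: clamp_middle_def field_simps)
  have in_unit: "(1 - t) * clamp_middle x + t * x \<in> {0<..<1}" if "0 \<le> t" "t \<le> 1" "0 < x" "x < 1" for t x
  proof (cases x "1/2 :: real" rule: linorder_cases)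
    case equal
    then have "(1 - t) * clamp_middle x + t * x = 1/2"
      using mid[of t] by (simp only:)
    then show ?thesis by simp
  qed (use side[of t x] side'[of t x] that in auto)
  have in_punct: "(1 - t) * clamp_middle x + t * x \<in> punctured" if "0 \<le> t" "t \<le> 1" "x \<in> punctured" for t x
    using side[of t x] side'[of t x] that by (cases x "1/2 :: real" rule: linorder_cases) auto
  have "homotopic_with (\<lambda>h. h \<in> punctured \<rightarrow> punctured) open_unit open_unit clamp_middle id"
    unfolding homotopic_with_def
  proof (intro exI[of _ ?h] conjI allI ballI)
    have "continuous_on ({0..1} \<times> {0<..<1}) ?h"
      by (intro continuous_intros continuous_on_compose2[OF continuous_clamp_middle[of UNIV]]) auto
    then show "continuous_map (prod_topology (top_of_set {0..1}) open_unit) open_unit ?h"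
      using in_unit by (auto simp: continuous_map_subtopology_eu)
  qed (use in_punct in auto)
  from homology_homotopy_axiom[OF this, of p] show ?thesis
    using hom_induced_id[OF assms] by simp
qed

text \<open>The space is compared with itself minus a single point of the edge. That complement is
  open, and excising everything outside \<open>A\<close> leaves an interval relative to its
  punctured part.\<close>

locale edge_in_space =
  fixes Y :: "'a topology" and A :: "'a set" and \<phi> :: "'a \<Rightarrow> real" and m :: 'a
  assumes open_A: "openin Y A"
    and coord: "homeomorphic_map (subtopology Y A) open_unit \<phi>"
    and m: "m \<in> A" "\<phi> m = 1/2"
    and closed_m: "closedin Y {m}"
begin

abbreviation "rest \<equiv> topspace Y - {m}"

lemma A_subset: "A \<subseteq> topspace Y"
  using open_A by (rule openin_subset)

lemma coord_image: "\<phi> ` (A - {m}) = punctured"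
proof -
  have bij: "bij_betw \<phi> A {0<..<1}"
    using homeomorphic_imp_injective_map[OF coord] homeomorphic_imp_surjective_map[OF coord]
    by (simp add: bij_betw_def Int_absorb1[OF A_subset])
  then have "\<phi> ` (A - {m}) = \<phi> ` A - \<phi> ` {m}"
    using m by (intro inj_on_image_set_diff[of _ A]) (auto simp: bij_betw_def)
  then show ?thesis
    using bij m by (simp add: bij_betw_def)
qed

lemma iso_excision:
  "hom_induced 1 (subtopology Y A) (A - {m}) Y rest id
     \<in> iso (relative_homology_group 1 (subtopology Y A) (A - {m})) (relative_homology_group 1 Y rest)"
proof -
  \<comment> \<open>Excision needs the closure of the removed set inside the interior of
    \<open>rest\<close>. The removed set is closed because \<open>A\<close> is open, and
    \<open>rest\<close> is open because \<open>{m}\<close> is closed.\<close>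
  have "Y closure_of (topspace Y - A) = topspace Y - A"
    using open_A by (intro closure_of_closedin) (simp add: openin_closedin_eq)
  moreover have "Y interior_of rest = rest"
    using closed_m by (intro interior_of_openin) (simp add: closedin_def)
  moreover have "topspace Y - (topspace Y - A) = A" "rest - (topspace Y - A) = A - {m}"
    using A_subset by auto
  ultimately show ?thesis
    using homology_excision_axiom[of Y "topspace Y - A" rest "topspace Y" 1] m by auto
qed

lemma iso_coord:
  "hom_induced 1 (subtopology Y A) (A - {m}) open_unit punctured \<phi>
     \<in> iso (relative_homology_group 1 (subtopology Y A) (A - {m})) (relative_homology_group 1 open_unit punctured)"
  by (rule homeomorphic_map_relative_homology_iso[OF coord]) (use A_subset coord_image in auto)

lemma relative_homology_edge: "relative_homology_group 1 Y rest \<cong> integer_group"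
proof -
  have "relative_homology_group 1 Y rest \<cong> relative_homology_group 1 (subtopology Y A) (A - {m})"
    by (rule group.iso_sym[OF group_relative_homology_group is_isoI[OF iso_excision]])
  also have "\<dots> \<cong> relative_homology_group 1 open_unit punctured"
    by (rule is_isoI[OF iso_coord])
  also have "\<dots> \<cong> integer_group"
    by (rule relative_homology_punctured)
  finally show ?thesis .
qed

lemma exactness:
  assumes "c \<in> carrier (homology_group 1 Y)"
    "hom_induced 1 Y {} Y rest id c = \<one>\<^bsub>relative_homology_group 1 Y rest\<^esub>"
  shows "c \<in> hom_induced 1 (subtopology Y rest) {} Y {} id ` carrier (homology_group 1 (subtopology Y rest))"
  using homology_exactness_axiom_3[of 1 Y rest] assms by (auto simp: kernel_def)

text \<open>The relative group \<open>H_1(Y, rest)\<close> is infinite cyclic, and by exactness the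
  kernel of \<open>H_1(Y) -> H_1(Y, rest)\<close> comes from \<open>rest\<close>.\<close>

lemma rank_at_most_insert_edge:
  assumes "rank_at_most (homology_group 1 (subtopology Y rest)) n"
  shows "rank_at_most (homology_group 1 Y) (Suc n)"
proof -
  obtain \<theta> where \<theta>: "\<theta> \<in> iso (relative_homology_group 1 Y rest) integer_group"
    using relative_homology_edge unfolding is_iso_def by blast
  then interpret \<theta>: group_hom "relative_homology_group 1 Y rest" integer_group \<theta>
    by (intro group_hom.intro group_hom_axioms.intro) (auto simp: iso_def)
  let ?k = "hom_induced 1 Y {} Y rest id"
  have k: "?k \<in> hom (homology_group 1 Y) (relative_homology_group 1 Y rest)"
    by (rule hom_induced_hom)
  show ?thesis
  proof (rule rank_at_most_extension[where k = "\<theta> \<circ> ?k"])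
    show "\<theta> \<circ> ?k \<in> hom (homology_group 1 Y) integer_group"
      by (rule hom_compose[OF k \<theta>.homh])
    fix c assume c: "c \<in> carrier (homology_group 1 Y)" "(\<theta> \<circ> ?k) c = 0"
    have "?k c \<in> carrier (relative_homology_group 1 Y rest)"
      using k c(1) by (auto simp: hom_def)
    moreover have "\<theta> (?k c) = \<theta> \<one>\<^bsub>relative_homology_group 1 Y rest\<^esub>"
      using \<theta>.hom_one c(2) by simp
    moreover have "inj_on \<theta> (carrier (relative_homology_group 1 Y rest))"
      using \<theta> by (simp add: iso_def bij_betw_def)
    ultimately have "?k c = \<one>\<^bsub>relative_homology_group 1 Y rest\<^esub>"
      using one_in_homology_group by (intro inj_onD[of \<theta> "carrier (relative_homology_group 1 Y rest)"])
    with c(1) show "c \<in> hom_induced 1 (subtopology Y rest) {} Y {} id ` carrier (homology_group 1 (subtopology Y rest))"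
      by (rule exactness)
  qed (use assms in \<open>auto simp: abelian_homology_group hom_induced_empty_hom\<close>)
qed

text \<open>The map \<open>H_1(Y) -> H_1(Y, rest)\<close> vanishes: followed by \<open>r\<close> it
  factors through the trivial \<open>H_1\<close> of the open interval, and \<open>r\<close> is
  injective on the relative group. By exactness every class then comes from \<open>rest\<close>,
  which has only the trivial one.\<close>

lemma trivial_insert_bridge:
  assumes triv: "trivial_group (homology_group 1 (subtopology Y rest))"
    and r: "continuous_map Y open_unit r" "r \<in> rest \<rightarrow> punctured" "\<And>x. x \<in> A \<Longrightarrow> r x = clamp_middle (\<phi> x)"
  shows "trivial_group (homology_group 1 Y)"
proof -
  let ?k = "hom_induced 1 Y {} Y rest id"
  let ?r = "hom_induced 1 Y rest open_unit punctured r"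
  have \<phi>: "continuous_map (subtopology Y A) open_unit \<phi>" "\<phi> \<in> A - {m} \<rightarrow> punctured"
    using homeomorphic_imp_continuous_map[OF coord] coord_image by auto
  have cl: "continuous_map open_unit open_unit clamp_middle" "clamp_middle \<in> punctured \<rightarrow> punctured"
    using continuous_clamp_middle by (auto simp: continuous_map_in_subtopology clamp_middle_def)
  have inc: "continuous_map (subtopology Y A) Y id" "id \<in> A - {m} \<rightarrow> rest"
    using A_subset by auto
  \<comment> \<open>By excision it suffices to look at \<open>A\<close>, where \<open>r\<close> is
    the coordinate followed by \<open>clamp_middle\<close>; the latter acts as the identity on
    relative homology.\<close>
  have r_inj: "y = \<one>\<^bsub>relative_homology_group 1 Y rest\<^esub>"
    if y: "y \<in> carrier (relative_homology_group 1 Y rest)"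
      "?r y = \<one>\<^bsub>relative_homology_group 1 open_unit punctured\<^esub>" for y
  proof -
    let ?A = "relative_homology_group 1 (subtopology Y A) (A - {m})"
    let ?\<phi> = "hom_induced 1 (subtopology Y A) (A - {m}) open_unit punctured \<phi>"
    let ?e = "hom_induced 1 (subtopology Y A) (A - {m}) Y rest id"
    obtain w where w: "w \<in> carrier ?A" "y = ?e w"
      using iso_excision y(1) by (auto simp: iso_def bij_betw_def)
    have w\<phi>: "?\<phi> w \<in> carrier (relative_homology_group 1 open_unit punctured)"
      using iso_coord w(1) by (auto simp: iso_def bij_betw_def)
    have "?r y = hom_induced 1 (subtopology Y A) (A - {m}) open_unit punctured (r \<circ> id) w"
      unfolding w(2) by (rule hom_induced_compose'[OF inc r(1,2)])
    also have "\<dots> = hom_induced 1 (subtopology Y A) (A - {m}) open_unit punctured (clamp_middle \<circ> \<phi>) w"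
    proof -
      have "hom_induced 1 (subtopology Y A) (A - {m}) open_unit punctured (r \<circ> id) =
        hom_induced 1 (subtopology Y A) (A - {m}) open_unit punctured (clamp_middle \<circ> \<phi>)"
        by (rule hom_induced_eq) (auto simp: r(3))
      then show ?thesis by simp
    qed
    also have "\<dots> = hom_induced 1 open_unit punctured open_unit punctured clamp_middle (?\<phi> w)"
      by (rule hom_induced_compose'[OF \<phi> cl, symmetric])
    also have "\<dots> = ?\<phi> w"
      by (rule hom_induced_clamp_middle[OF w\<phi>])
    finally have "?\<phi> w = \<one>\<^bsub>relative_homology_group 1 open_unit punctured\<^esub>"
      using y(2) by simp
    moreover have "?\<phi> \<one>\<^bsub>?A\<^esub> = \<one>\<^bsub>relative_homology_group 1 open_unit punctured\<^esub>"
      by (rule hom_one[OF hom_induced_hom]) auto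
    moreover have "inj_on ?\<phi> (carrier ?A)"
      using iso_coord by (auto simp: iso_def bij_betw_def)
    ultimately have "w = \<one>\<^bsub>?A\<^esub>"
      using w(1) one_in_homology_group by (intro inj_onD[of ?\<phi> "carrier ?A"]) simp_all
    then show ?thesis
      unfolding w(2) by (simp only:) (rule hom_one[OF hom_induced_hom], auto)
  qed
  have "c = \<one>\<^bsub>homology_group 1 Y\<^esub>" if c: "c \<in> carrier (homology_group 1 Y)" for c
  proof -
    have "?r (?k c) = hom_induced 1 Y {} open_unit punctured (r \<circ> id) c"
      by (rule hom_induced_compose'[OF _ _ r(1,2)]) auto
    also have "\<dots> = hom_induced 1 Y {} open_unit punctured (id \<circ> r) c"
      by simp
    also have "\<dots> = hom_induced 1 open_unit {} open_unit punctured id (hom_induced 1 Y {} open_unit {} r c)"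
      by (rule hom_induced_compose'[OF r(1) _ continuous_map_id, symmetric]) auto
    also have "hom_induced 1 Y {} open_unit {} r c = \<one>\<^bsub>homology_group 1 open_unit\<^esub>"
    proof -
      have "hom_induced 1 Y {} open_unit {} r c \<in> carrier (homology_group 1 open_unit)"
        by (rule hom_induced_carrier)
      then show ?thesis
        using trivial_homology_open_unit by (auto simp: trivial_group_def)
    qed
    also have "hom_induced 1 open_unit {} open_unit punctured id \<one>\<^bsub>homology_group 1 open_unit\<^esub>
        = \<one>\<^bsub>relative_homology_group 1 open_unit punctured\<^esub>"
      by (rule hom_one[OF hom_induced_hom]) auto
    finally have "?k c = \<one>\<^bsub>relative_homology_group 1 Y rest\<^esub>"
      by (intro r_inj hom_induced_carrier)
    from exactness[OF c this] obtain d where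
      d: "d \<in> carrier (homology_group 1 (subtopology Y rest))" "c = hom_induced 1 (subtopology Y rest) {} Y {} id d"
      by blast
    then have "d = \<one>\<^bsub>homology_group 1 (subtopology Y rest)\<^esub>"
      using triv by (auto simp: trivial_group_def)
    then show ?thesis
      unfolding d(2) by (simp only:) (rule hom_one[OF hom_induced_hom], auto)
  qed
  then have "carrier (homology_group 1 Y) = {\<one>\<^bsub>homology_group 1 Y\<^esub>}"
    using one_in_homology_group[of 1 Y "{}"] by blast
  then show ?thesis
    unfolding trivial_group_def by simp
qed

end

text \<open>Additivity reduces the claim to singletons, which the dimension axiom settles.\<close>

lemma trivial_homology_discrete:
  assumes "p \<noteq> 0"
  shows "trivial_group (homology_group p (discrete_topology U))"
proof -
  let ?\<U> = "(\<lambda>x. {x}) ` U"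
  let ?G = "\<lambda>S. homology_group p (subtopology (discrete_topology U) S)"
  have grp: "group (sum_group ?\<U> ?G)"
    by simp
  have iso: "sum_group ?\<U> ?G \<cong> homology_group p (discrete_topology U)"
    by (rule is_isoI[OF homology_additivity_axiom]) (auto simp: pairwise_def)
  have "trivial_group (?G S)" if "S \<in> ?\<U>" for S
    using that assms by (elim imageE) (rule homology_dimension_axiom, auto)
  then have triv: "carrier (?G S) = {\<one>\<^bsub>?G S\<^esub>}" if "S \<in> ?\<U>" for S
    using that by (simp add: trivial_group_def)
  have "x = \<one>\<^bsub>sum_group ?\<U> ?G\<^esub>" if x: "x \<in> carrier (sum_group ?\<U> ?G)" for x
  proof -
    have xE: "x \<in> (\<Pi>\<^sub>E S\<in>?\<U>. carrier (?G S))"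
      using x by (subst (asm) carrier_sum_group) simp_all
    have "x S = \<one>\<^bsub>?G S\<^esub>" if "S \<in> ?\<U>" for S
      using PiE_mem[OF xE that] unfolding triv[OF that] by (rule singletonD)
    with xE have "x = (\<lambda>S\<in>?\<U>. \<one>\<^bsub>?G S\<^esub>)"
      by (intro extensionalityI[of _ ?\<U>]) (simp_all add: PiE_iff)
    then show ?thesis
      by (simp only: one_sum_group)
  qed
  then have "trivial_group (sum_group ?\<U> ?G)"
    unfolding trivial_group_def using grp monoid.one_closed[OF group.is_monoid[OF grp]] by blast
  then show ?thesis
    using isomorphic_group_triviality[OF iso grp group_relative_homology_group] by simp
qed

section \<open>Homology of a finite graph\<close>

text \<open>A product with a discrete factor is a disjoint union of copies of \<open>Z\<close>, so
  openness is tested slice by slice.\<close>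

lemma openin_prod_discrete_topology:
  "openin (prod_topology (discrete_topology K) Z) W \<longleftrightarrow>
     W \<subseteq> K \<times> topspace Z \<and> (\<forall>k\<in>K. openin Z {z \<in> topspace Z. (k, z) \<in> W})" (is "?L \<longleftrightarrow> ?R")
proof
  assume W: ?L
  have "openin Z {z \<in> topspace Z. (k, z) \<in> W}" if "k \<in> K" for k
  proof -
    have "continuous_map Z (prod_topology (discrete_topology K) Z) (\<lambda>z. (k, z))"
      using that by (auto simp: continuous_map_pairwise o_def)
    from openin_continuous_map_preimage[OF this W] show ?thesis .
  qed
  then show ?R
    using openin_subset[OF W] by simp
next
  assume R: ?R
  have "openin (prod_topology (discrete_topology K) Z) (\<Union>k\<in>K. {k} \<times> {z \<in> topspace Z. (k, z) \<in> W})"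
    using R by (intro openin_Union) (auto simp: openin_prod_Times_iff)
  also have "(\<Union>k\<in>K. {k} \<times> {z \<in> topspace Z. (k, z) \<in> W}) = W"
    using R by auto
  finally show ?L .
qed

section \<open>Edges and cuts in a graph realization\<close>

locale graph =
  fixes V :: "'v set" and E :: "'e set" and s t :: "'e \<Rightarrow> 'v"
  assumes ends: "s \<in> E \<rightarrow> V" "t \<in> E \<rightarrow> V"
begin

abbreviation "G \<equiv> graph_realization V E s t"

definition arc :: "'e \<Rightarrow> real set \<Rightarrow> ('v + 'e \<times> real) set" where
  "arc e W = Inr ` ({e} \<times> W)"

definition mid :: "'e \<Rightarrow> 'v + 'e \<times> real" where
  "mid e = Inr (e, 1/2)"

definition cut :: "'e set \<Rightarrow> ('v + 'e \<times> real) set" where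
  "cut S = topspace G - mid ` S"

text \<open>The coordinate along an edge; it is only meaningful on open edges.\<close>

definition coord :: "'v + 'e \<times> real \<Rightarrow> real" where
  "coord z = snd (projr z)"

lemma topspace_G: "topspace G = Inl ` V \<union> Inr ` (E \<times> {0<..<1})"
  by (rule topspace_graph_realization[OF ends])

lemma edge_map_in: "e \<in> E \<Longrightarrow> r \<in> {0..1} \<Longrightarrow> edge_map s t e r \<in> topspace G"
  using ends by (auto simp: topspace_G edge_map_def)

lemma openinI:
  assumes "U \<subseteq> topspace G"
    "\<And>e. e \<in> E \<Longrightarrow> openin (top_of_set {0..1}) {r \<in> {0..1}. edge_map s t e r \<in> U}"
  shows "openin G U"
  using assms by (auto simp: openin_graph_realization topspace_G)

lemma continuous_edge_map: "e \<in> E \<Longrightarrow> continuous_map (top_of_set {0..1}) G (edge_map s t e)"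
  unfolding continuous_map using edge_map_in by (auto simp: openin_graph_realization)

lemma arc_subset: "e \<in> E \<Longrightarrow> W \<subseteq> {0<..<1} \<Longrightarrow> arc e W \<subseteq> topspace G"
  by (auto simp: arc_def topspace_G)

lemma edge_map_in_arc: "W \<subseteq> {0<..<1} \<Longrightarrow> edge_map s t e' r \<in> arc e W \<longleftrightarrow> e' = e \<and> r \<in> W"
  by (auto simp: arc_def edge_map_def)

lemma edge_map_mid: "edge_map s t e r = mid e' \<longleftrightarrow> e = e' \<and> r = 1/2"
  by (auto simp: mid_def edge_map_def)

lemma openin_arc:
  assumes "e \<in> E" "open W" "W \<subseteq> {0<..<1}"
  shows "openin G (arc e W)"
proof (rule openinI)
  fix e' assume "e' \<in> E"
  have "{r \<in> {0..1}. edge_map s t e' r \<in> arc e W} = {0..1} \<inter> (if e' = e then W else {})"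
    using assms(3) by (auto simp: edge_map_in_arc)
  then show "openin (top_of_set {0..1}) {r \<in> {0..1}. edge_map s t e' r \<in> arc e W}"
    using assms(2) by (simp add: openin_open_Int)
qed (rule arc_subset[OF assms(1,3)])

lemma closedin_arc:
  assumes "e \<in> E" "closed W" "W \<subseteq> {0<..<1}"
  shows "closedin G (arc e W)"
  unfolding closedin_def
proof (intro conjI openinI)
  fix e' assume e': "e' \<in> E"
  have "{r \<in> {0..1}. edge_map s t e' r \<in> topspace G - arc e W} = {0..1} \<inter> - (if e' = e then W else {})"
    using assms(3) edge_map_in[OF e'] by (auto simp: edge_map_in_arc)
  then show "openin (top_of_set {0..1}) {r \<in> {0..1}. edge_map s t e' r \<in> topspace G - arc e W}"
    using assms(2) by (auto simp: openin_open_Int open_Compl)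
qed (use arc_subset[OF assms(1,3)] in auto)

lemma closedin_mid: "e \<in> E \<Longrightarrow> closedin G {mid e}"
  using closedin_arc[of e "{1/2}"] by (simp add: arc_def mid_def)

lemma openin_cut: "S \<subseteq> E \<Longrightarrow> openin G (cut S)"
proof (rule openinI)
  fix e' assume e': "e' \<in> E"
  have "{r \<in> {0..1}. edge_map s t e' r \<in> cut S} = {0..1} \<inter> - (if e' \<in> S then {1/2} else {})"
    using edge_map_in[OF e'] by (auto simp: cut_def edge_map_mid image_iff)
  then show "openin (top_of_set {0..1}) {r \<in> {0..1}. edge_map s t e' r \<in> cut S}"
    by (auto simp: openin_open_Int open_Compl)
qed (auto simp: cut_def)

lemma cut_subset: "cut S \<subseteq> topspace G"
  by (auto simp: cut_def)

lemma cut_empty: "cut {} = topspace G"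
  by (simp add: cut_def)

lemma topspace_cut: "topspace (subtopology G (cut S)) = cut S"
  using cut_subset by auto

lemma cut_insert: "cut (insert e S) = cut S - {mid e}"
  by (auto simp: cut_def)

lemma cut_antimono: "S \<subseteq> T \<Longrightarrow> cut T \<subseteq> cut S"
  by (auto simp: cut_def)

lemma arc_cut: "e \<in> E \<Longrightarrow> e \<notin> S \<Longrightarrow> W \<subseteq> {0<..<1} \<Longrightarrow> arc e W \<subseteq> cut S"
  by (auto simp: arc_def cut_def mid_def topspace_G)

lemma homeomorphic_coord:
  assumes e: "e \<in> E"
  shows "homeomorphic_map (subtopology G (arc e {0<..<1})) open_unit coord"
proof -
  let ?A = "arc e {0<..<1}"
  have top: "topspace (subtopology G ?A) = ?A"
    using arc_subset[OF e] by auto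
  have "homeomorphic_maps (subtopology G ?A) open_unit coord (\<lambda>r. Inr (e, r))"
    unfolding homeomorphic_maps_def top
  proof (intro conjI)
    show "continuous_map (subtopology G ?A) open_unit coord"
      unfolding continuous_map_in_subtopology
    proof (intro conjI)
      show "continuous_map (subtopology G ?A) euclideanreal coord"
        unfolding continuous_map
      proof (intro conjI allI impI)
        fix W :: "real set" assume "openin euclideanreal W"
        then have "openin G (arc e (W \<inter> {0<..<1}))"
          by (intro openin_arc e) auto
        moreover have "{z \<in> topspace (subtopology G ?A). coord z \<in> W} = arc e (W \<inter> {0<..<1}) \<inter> ?A"
          unfolding top by (auto simp: arc_def coord_def)
        ultimately show "openin (subtopology G ?A) {z \<in> topspace (subtopology G ?A). coord z \<in> W}"
          by (auto simp: openin_subtopology)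
      qed auto
      show "coord \<in> topspace (subtopology G ?A) \<rightarrow> {0<..<1}"
        unfolding top by (auto simp: arc_def coord_def)
    qed
    show "continuous_map open_unit (subtopology G ?A) (\<lambda>r. Inr (e, r))"
      unfolding continuous_map_in_subtopology
    proof (intro conjI)
      have "continuous_map open_unit G (edge_map s t e)"
        by (rule continuous_map_from_subtopology_mono[OF continuous_edge_map[OF e]]) auto
      then show "continuous_map open_unit G (\<lambda>r. Inr (e, r))"
        by (rule continuous_map_eq) (auto simp: edge_map_def)
    qed (auto simp: arc_def)
  qed (auto simp: arc_def coord_def)
  then show ?thesis
    by (auto simp: homeomorphic_map_maps)
qed

lemma edge_in_cut:
  assumes "S \<subseteq> E" "e \<in> E" "e \<notin> S"
  shows "edge_in_space (subtopology G (cut S)) (arc e {0<..<1}) coord (mid e)"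
proof
  have A: "arc e {0<..<1} \<subseteq> cut S"
    using assms by (intro arc_cut) auto
  show "openin (subtopology G (cut S)) (arc e {0<..<1})"
    using A openin_arc[of e "{0<..<1}"] assms by (simp add: openin_cut openin_open_subtopology)
  show "homeomorphic_map (subtopology (subtopology G (cut S)) (arc e {0<..<1})) open_unit coord"
    using A homeomorphic_coord[OF assms(2)] by (simp add: subtopology_subtopology Int_absorb1)
  show m: "mid e \<in> arc e {0<..<1}"
    by (auto simp: mid_def arc_def)
  show "coord (mid e) = 1/2"
    by (simp add: coord_def mid_def)
  show "closedin (subtopology G (cut S)) {mid e}"
    using closedin_mid[OF assms(2)] m A by (intro closedin_subset_topspace) auto
qed

lemma rest_cut:
  "subtopology (subtopology G (cut S)) (topspace (subtopology G (cut S)) - {mid e}) = subtopology G (cut (insert e S))"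
  unfolding topspace_cut cut_insert by (simp add: subtopology_subtopology Int_absorb1 Diff_subset)

lemma rank_cut_insert:
  assumes "S \<subseteq> E" "e \<in> E" "e \<notin> S"
    and "rank_at_most (homology_group 1 (subtopology G (cut (insert e S)))) n"
  shows "rank_at_most (homology_group 1 (subtopology G (cut S))) (Suc n)"
  by (rule edge_in_space.rank_at_most_insert_edge[OF edge_in_cut[OF assms(1-3)]])
     (use assms(4) in \<open>simp only: rest_cut\<close>)

text \<open>\<open>C\<close> and \<open>D\<close> are two sides of the cut at \<open>e\<close>.
  Collapsing the part of each side beyond the edge to 1/4 or 3/4 gives the map to the interval that
  \<open>trivial_insert_bridge\<close> asks for.\<close>

lemma trivial_cut_insert:
  assumes "S \<subseteq> E" "e \<in> E" "e \<notin> S"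
    and CD: "openin G C" "openin G D" "C \<inter> D = {}" "C \<union> D = cut (insert e S)"
      "arc e {0<..<1/2} \<subseteq> C" "arc e {1/2<..<1} \<subseteq> D"
    and triv: "trivial_group (homology_group 1 (subtopology G (cut (insert e S))))"
  shows "trivial_group (homology_group 1 (subtopology G (cut S)))"
proof (rule edge_in_space.trivial_insert_bridge[OF edge_in_cut[OF assms(1-3)]])
  let ?Y = "subtopology G (cut S)"
  let ?A = "arc e {0<..<1}"
  show "trivial_group (homology_group 1 (subtopology ?Y (topspace ?Y - {mid e})))"
    using triv by (simp only: rest_cut)
  define r where "r z = (if z \<in> ?A then clamp_middle (coord z) else if z \<in> C then 1/4 else 3/4)" for z
  show "r z = clamp_middle (coord z)" if "z \<in> ?A" for z
    using that by (simp add: r_def)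
  have A: "?A \<subseteq> cut S"
    using assms by (intro arc_cut) auto
  have CDcut: "C \<subseteq> cut S" "D \<subseteq> cut S"
    using CD(4) cut_antimono[of S "insert e S"] by auto
  have A_split: "z \<in> C \<and> coord z < 1/2 \<or> z \<in> D \<and> coord z > 1/2 \<or> z = mid e" if "z \<in> ?A" for z
  proof -
    from that obtain x where x: "z = Inr (e, x)" "0 < x" "x < 1" by (auto simp: arc_def)
    then show ?thesis
      using CD(5,6) by (cases x "1/2 :: real" rule: linorder_cases) (auto simp: arc_def mid_def coord_def)
  qed
  have clamp: "clamp_middle x \<in> {0<..<1}" for x
    by (auto simp: clamp_middle_def)
  show "r \<in> topspace ?Y - {mid e} \<rightarrow> punctured"
  proof
    fix z assume z: "z \<in> topspace ?Y - {mid e}"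
    show "r z \<in> punctured"
    proof (cases "z \<in> ?A")
      case True
      with A_split[OF this] z have "coord z \<noteq> 1/2" by auto
      with True clamp[of "coord z"] show ?thesis
        by (auto simp: r_def clamp_middle_def)
    qed (simp add: r_def)
  qed
  \<comment> \<open>Removing this closed middle part leaves \<open>C - K\<close> and
    \<open>D - K\<close> open, and they meet the edge only in its outer quarters, where the clamped
    coordinate is already constant. So the three pieces form an open cover on which the definitions
    agree.\<close>
  define K where "K = arc e {1/4..3/4}"
  have K: "closedin G K"
    unfolding K_def using assms by (intro closedin_arc) auto
  have KA: "K \<subseteq> ?A"
    by (auto simp: K_def arc_def)
  define T where "T i = (if i = 0 then ?A else if i = 1 then C - K else D - K)" for i :: nat
  define g where "g i z = (if i = 0 then clamp_middle (coord z) else if i = 1 then 1/4 else 3/4)" for i :: nat and z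
  have rC: "r z = 1/4" if "z \<in> C - K" for z
  proof (cases "z \<in> ?A")
    case True
    with A_split[OF this] that CD(3) have "coord z < 1/2"
      using CD(4) cut_insert by blast
    moreover have "coord z < 1/4"
      using that True calculation by (auto simp: K_def arc_def coord_def)
    ultimately show ?thesis
      using True by (simp add: r_def clamp_middle_def)
  qed (use that in \<open>simp add: r_def\<close>)
  have rD: "r z = 3/4" if "z \<in> D - K" for z
  proof (cases "z \<in> ?A")
    case True
    with A_split[OF this] that CD(3) have "coord z > 1/2"
      using CD(4) cut_insert by blast
    moreover have "coord z > 3/4"
      using that True calculation by (auto simp: K_def arc_def coord_def)
    ultimately show ?thesis
      using True by (simp add: r_def clamp_middle_def)
  next
    case False
    then show ?thesis using that CD(3) by (auto simp: r_def)
  qed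
  have gr: "g i z = r z" if iz: "i \<in> {0,1,2}" "z \<in> T i" for i z
  proof -
    consider "i = 0" | "i = 1" | "i = 2" using iz(1) by blast
    then show ?thesis
    proof cases
      case 1
      then show ?thesis using iz(2) by (simp add: g_def T_def r_def)
    next
      case 2
      then show ?thesis using iz(2) rC[of z] by (simp add: g_def T_def)
    next
      case 3
      then show ?thesis using iz(2) rD[of z] by (simp add: g_def T_def)
    qed
  qed
  show "continuous_map ?Y open_unit r"
  proof (rule pasting_lemma[where I = "{0,1,2}" and T = T and f = g])
    fix i :: nat assume i: "i \<in> {0,1,2}"
    have "openin G (T i)" "T i \<subseteq> cut S"
      using i A CDcut CD K assms openin_arc[of e "{0<..<1}"] by (auto simp: T_def intro: openin_diff)
    then show "openin ?Y (T i)"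
      by (simp add: openin_open_subtopology openin_cut assms)
    show "continuous_map (subtopology ?Y (T i)) open_unit (g i)"
    proof (cases "i = 0")
      case True
      have "continuous_map (subtopology G ?A) open_unit coord"
        by (rule homeomorphic_imp_continuous_map[OF homeomorphic_coord[OF assms(2)]])
      moreover have "continuous_map open_unit open_unit clamp_middle"
        using clamp continuous_clamp_middle by (auto simp: continuous_map_in_subtopology)
      ultimately have "continuous_map (subtopology G ?A) open_unit (clamp_middle \<circ> coord)"
        by (rule continuous_map_compose)
      moreover have "g i = clamp_middle \<circ> coord"
        using True by (simp add: g_def fun_eq_iff)
      ultimately show ?thesis
        using True A by (simp add: T_def subtopology_subtopology Int_absorb1)
    next
      case False
      then have "g i = (\<lambda>_. if i = 1 then 1/4 else 3/4)"
        by (simp add: g_def fun_eq_iff)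
      then show ?thesis
        by simp
    qed
  next
    fix i j z assume "i \<in> {0,1,2::nat}" "j \<in> {0,1,2::nat}" "z \<in> topspace ?Y \<inter> T i \<inter> T j"
    then show "g i z = g j z"
      using gr by auto
  next
    fix z assume "z \<in> topspace ?Y"
    then have "z \<in> cut S" by simp
    then have "z \<in> ?A \<or> z \<in> C - K \<or> z \<in> D - K"
      using CD(4) KA by (cases "z = mid e") (auto simp: cut_insert mid_def arc_def)
    then have "z \<in> T 0 \<or> z \<in> T 1 \<or> z \<in> T 2"
      by (simp add: T_def)
    then obtain i where "i \<in> {0,1,2}" "z \<in> T i"
      by blast
    with gr show "\<exists>j. j \<in> {0,1,2} \<and> z \<in> T j \<and> r z = g j z"
      by metis
  qed
qed

section \<open>The realization as a quotient of disjoint cells\<close>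

definition cover_map :: "('v + 'e) \<times> real \<Rightarrow> 'v + 'e \<times> real" where
  "cover_map z = (case fst z of Inl v \<Rightarrow> Inl v | Inr e \<Rightarrow> edge_map s t e (snd z))"

abbreviation "cells \<equiv> Inl ` V \<union> Inr ` E"

text \<open>Vertices also receive a copy of the unit interval, which \<open>cover_map\<close>
  collapses; thus all cells have one shape and isolated vertices are covered too.\<close>

abbreviation "disjoint_cells \<equiv> prod_topology (discrete_topology cells) (top_of_set {0..1::real})"

lemma cover_map_simps [simp]:
  "cover_map (Inl v, r) = Inl v" "cover_map (Inr e, r) = edge_map s t e r"
  by (simp_all add: cover_map_def)

text \<open>The weak topology is the quotient topology of the cells: the preimage in a vertex cell
  is everything or nothing, so only the edges impose a condition.\<close>

lemma quotient_map_cover_map: "quotient_map disjoint_cells G cover_map"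
  unfolding quotient_map_def
proof (intro conjI allI impI)
  show "cover_map ` topspace disjoint_cells = topspace G"
  proof (intro equalityI subsetI)
    fix x assume "x \<in> cover_map ` topspace disjoint_cells"
    then show "x \<in> topspace G"
      using edge_map_in by (auto simp: topspace_G[symmetric]) (auto simp: topspace_G)
  next
    fix x assume "x \<in> topspace G"
    then consider v where "v \<in> V" "x = Inl v" | e r where "e \<in> E" "0 < r" "r < 1" "x = Inr (e, r)"
      by (auto simp: topspace_G)
    then show "x \<in> cover_map ` topspace disjoint_cells"
    proof cases
      case 1
      then show ?thesis by (intro image_eqI[of _ _ "(Inl v, 0)"]) auto
    next
      case 2
      then show ?thesis by (intro image_eqI[of _ _ "(Inr e, r)"]) (auto simp: edge_map_def)
    qed
  qed
  fix U assume U: "U \<subseteq> topspace G"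
  have "openin disjoint_cells {x \<in> topspace disjoint_cells. cover_map x \<in> U} \<longleftrightarrow>
      (\<forall>k\<in>cells. openin (top_of_set {0..1}) {r \<in> {0..1}. cover_map (k, r) \<in> U})"
    unfolding openin_prod_discrete_topology by (auto cong: conj_cong)
  also have "\<dots> \<longleftrightarrow> (\<forall>e\<in>E. openin (top_of_set {0..1}) {r \<in> {0..1}. edge_map s t e r \<in> U})"
  proof -
    have "openin (top_of_set {0..1}) {r \<in> {0..1}. cover_map (Inl v, r) \<in> U}" for v
    proof -
      have "{r \<in> {0..1}. cover_map (Inl v, r) \<in> U} = (if Inl v \<in> U then {0..1} else {})"
        by auto
      then show ?thesis
        using openin_topspace[of "top_of_set {0..1::real}"] by simp
    qed
    then show ?thesis by (simp add: ball_Un)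
  qed
  also have "\<dots> \<longleftrightarrow> openin G U"
    using U by (auto simp: openin_graph_realization topspace_G)
  finally show "openin disjoint_cells {x \<in> topspace disjoint_cells. cover_map x \<in> U} = openin G U" .
qed

section \<open>Deformation of the cut graph into its vertices\<close>

definition pull :: "real \<Rightarrow> real \<Rightarrow> real" where
  "pull \<tau> r = (1 - \<tau>) * r + \<tau> * (if r < 1/2 then 0 else 1)"

text \<open>Points move linearly to the nearer end, and the choice of the end jumps only at 1/2, the
  point that the cut removes.\<close>

lemma continuous_pull: "continuous_on (UNIV \<times> (- {1/2})) (\<lambda>z. pull (fst z) (snd z))"
proof -
  have eq: "UNIV \<times> (- {1/2}) = UNIV \<times> {..<1/2} \<union> (UNIV \<times> {1/2<..} :: (real \<times> real) set)"
    by auto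
  have 1: "continuous_on (UNIV \<times> {..<1/2}) (\<lambda>z. pull (fst z) (snd z))"
    by (rule continuous_on_eq[of _ "\<lambda>z. (1 - fst z) * snd z"]) (auto simp: pull_def intro!: continuous_intros)
  have 2: "continuous_on (UNIV \<times> {1/2<..}) (\<lambda>z. pull (fst z) (snd z))"
    by (rule continuous_on_eq[of _ "\<lambda>z. (1 - fst z) * snd z + fst z"]) (auto simp: pull_def intro!: continuous_intros)
  show ?thesis
    unfolding eq by (rule continuous_on_open_Un) (use 1 2 in \<open>auto intro: open_Times\<close>)
qed

lemma pull_in:
  assumes "\<tau> \<in> {0..1}" "r \<in> {0..1} - {1/2}"
  shows "pull \<tau> r \<in> {0..1} - {1/2}"
proof (cases "r < 1/2")
  case True
  have "(1 - \<tau>) * r \<le> 1 * r"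
    using assms by (intro mult_right_mono) auto
  then show ?thesis
    using assms True by (auto simp: pull_def)
next
  case False
  \<comment> \<open>Mirror image of the left half: the distance to 1 is multiplied by
    \<open>1 - \<tau>\<close>.\<close>
  have "(1 - \<tau>) * (1 - r) \<le> 1 * (1 - r)"
    using assms by (intro mult_right_mono) auto
  moreover have "0 \<le> (1 - \<tau>) * (1 - r)"
    using assms by auto
  moreover have "pull \<tau> r = 1 - (1 - \<tau>) * (1 - r)"
    using False by (simp add: pull_def algebra_simps)
  ultimately show ?thesis
    using assms False by auto
qed

definition retract :: "real \<Rightarrow> 'v + 'e \<times> real \<Rightarrow> 'v + 'e \<times> real" where
  "retract \<tau> z = (case z of Inl v \<Rightarrow> Inl v | Inr (e, r) \<Rightarrow> edge_map s t e (pull \<tau> r))"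

lemma retract_edge_map: "retract \<tau> (edge_map s t e r) = edge_map s t e (pull \<tau> r)"
  by (auto simp: retract_def edge_map_def pull_def)

lemma edge_map_in_cut: "e \<in> E \<Longrightarrow> r \<in> {0..1} \<Longrightarrow> edge_map s t e r \<in> cut E \<longleftrightarrow> r \<noteq> 1/2"
  using edge_map_in by (auto simp: cut_def edge_map_mid image_iff)

text \<open>The obstacle is the parameter: a quotient map times an identity need not be a quotient
  map, but it is one here because the unit interval is locally compact Hausdorff. Continuity is then
  checked on the disjoint cells, where an edge is moved by \<open>pull\<close> followed by its
  characteristic map.\<close>

lemma continuous_retract:
  "continuous_map (prod_topology (top_of_set {0..1}) (subtopology G (cut E))) (subtopology G (cut E))
     (\<lambda>z. retract (fst z) (snd z))"
proof -
  let ?I = "top_of_set {0..1::real}"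
  let ?Y = "subtopology G (cut E)"
  define P where "P = subtopology disjoint_cells {x \<in> topspace disjoint_cells. cover_map x \<in> cut E}"
  have topP: "topspace P = {x \<in> cells \<times> {0..1}. cover_map x \<in> cut E}"
    by (auto simp: P_def)
  have "quotient_map P ?Y cover_map"
    unfolding P_def by (rule quotient_map_restriction[OF quotient_map_cover_map refl]) (simp add: openin_cut)
  then have Q: "quotient_map (prod_topology ?I P) (prod_topology ?I ?Y) (\<lambda>(x, y). (x, cover_map y))"
    by (intro quotient_map_prod_right) (auto simp: compact_space_subtopology
        intro!: compact_imp_locally_compact_space Hausdorff_space_subtopology)
  have "continuous_map (prod_topology ?I P) ?Y (\<lambda>z. retract (fst z) (cover_map (snd z)))"
  proof (rule pasting_lemma[where I = cells and T = "\<lambda>k. {z \<in> topspace (prod_topology ?I P). fst (snd z) = k}"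
        and f = "\<lambda>k z. retract (fst z) (cover_map (snd z))"])
    \<comment> \<open>The index of the cell is a continuous map to a discrete space, so every cell
      is open upstairs and the pieces can be pasted.\<close>
    have cont_cell: "continuous_map (prod_topology ?I P) (discrete_topology cells) (fst \<circ> snd)"
      unfolding P_def
      by (intro continuous_map_compose[OF continuous_map_snd] continuous_map_from_subtopology continuous_map_fst)
    have cont_par: "continuous_map (prod_topology ?I P) ?I (snd \<circ> snd)"
      unfolding P_def
      by (intro continuous_map_compose[OF continuous_map_snd] continuous_map_from_subtopology continuous_map_snd)
    fix k assume k: "k \<in> cells"
    let ?T = "{z \<in> topspace (prod_topology ?I P). fst (snd z) = k}"
    show "openin (prod_topology ?I P) ?T"
      using openin_continuous_map_preimage[OF cont_cell, of "{k}"] k by simp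
    show "continuous_map (subtopology (prod_topology ?I P) ?T) ?Y (\<lambda>z. retract (fst z) (cover_map (snd z)))"
    proof (cases k)
      case (Inl v)
      then have "Inl v \<in> topspace ?Y"
        using k by (auto simp: topspace_G cut_def mid_def)
      then have "continuous_map (subtopology (prod_topology ?I P) ?T) ?Y (\<lambda>_. Inl v)"
        by simp
      then show ?thesis
        by (rule continuous_map_eq) (auto simp: cover_map_def Inl retract_def)
    next
      case (Inr e)
      then have e: "e \<in> E" using k by auto
      have par: "snd (snd z) \<in> {0..1} - {1/2}" "fst z \<in> {0..1}" "cover_map (snd z) = edge_map s t e (snd (snd z))"
        if "z \<in> ?T" for z
        using that e by (auto simp: topP Inr cover_map_def edge_map_in_cut)
      have "continuous_map (prod_topology ?I P) (prod_topology euclidean euclidean) (\<lambda>z. (fst z, snd (snd z)))"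
        unfolding continuous_map_paired
        using cont_par continuous_map_fst[of ?I P]
        by (auto simp: continuous_map_in_subtopology o_def)
      then have "continuous_map (prod_topology ?I P) (euclidean :: (real \<times> real) topology) (\<lambda>z. (fst z, snd (snd z)))"
        by simp
      then have "continuous_map (subtopology (prod_topology ?I P) ?T) (top_of_set (UNIV \<times> (- {1/2 :: real}))) (\<lambda>z. (fst z, snd (snd z)))"
        using par by (auto simp: continuous_map_in_subtopology intro: continuous_map_from_subtopology)
      moreover have "continuous_map (top_of_set (UNIV \<times> (- {1/2 :: real}))) euclideanreal (\<lambda>z. pull (fst z) (snd z))"
        using continuous_pull by simp
      ultimately have "continuous_map (subtopology (prod_topology ?I P) ?T) euclideanreal ((\<lambda>z. pull (fst z) (snd z)) \<circ> (\<lambda>z. (fst z, snd (snd z))))"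
        by (rule continuous_map_compose)
      then have "continuous_map (subtopology (prod_topology ?I P) ?T) euclideanreal (\<lambda>z. pull (fst z) (snd (snd z)))"
        by (simp add: o_def)
      moreover have pull: "pull (fst z) (snd (snd z)) \<in> {0..1} - {1/2}" if "z \<in> ?T" for z
        using par[OF that] by (intro pull_in)
      ultimately have "continuous_map (subtopology (prod_topology ?I P) ?T) ?I (\<lambda>z. pull (fst z) (snd (snd z)))"
        by (auto simp: continuous_map_in_subtopology)
      from continuous_map_compose[OF this continuous_edge_map[OF e]]
      have "continuous_map (subtopology (prod_topology ?I P) ?T) G (\<lambda>z. edge_map s t e (pull (fst z) (snd (snd z))))"
        by (simp add: o_def)
      moreover have "edge_map s t e (pull (fst z) (snd (snd z))) \<in> cut E" if "z \<in> ?T" for z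
        using pull[OF that] e by (simp add: edge_map_in_cut)
      ultimately have "continuous_map (subtopology (prod_topology ?I P) ?T) ?Y (\<lambda>z. edge_map s t e (pull (fst z) (snd (snd z))))"
        by (auto simp: continuous_map_in_subtopology)
      then show ?thesis
        by (rule continuous_map_eq) (use par in \<open>auto simp: retract_edge_map\<close>)
    qed
  qed (auto simp: topP)
  then have "continuous_map (prod_topology ?I P) ?Y ((\<lambda>z. retract (fst z) (snd z)) \<circ> (\<lambda>(x, y). (x, cover_map y)))"
    by (simp add: o_def case_prod_unfold)
  then show ?thesis
    by (rule continuous_compose_quotient_map[OF Q])
qed

text \<open>The identity is homotopic to \<open>retract 1\<close>, which factors through the
  discrete set of vertices; so the identity of \<open>H_1\<close> factors through a trivial
  group.\<close>

lemma trivial_cut_all: "trivial_group (homology_group 1 (subtopology G (cut E)))"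
proof -
  let ?Y = "subtopology G (cut E)"
  let ?D = "discrete_topology (Inl ` V :: ('v + 'e \<times> real) set)"
  have in_cut: "z \<in> Inl ` V \<or> (\<exists>e r. e \<in> E \<and> 0 < r \<and> r < 1 \<and> r \<noteq> 1/2 \<and> z = Inr (e, r))" if "z \<in> cut E" for z
    using that by (auto simp: cut_def topspace_G mid_def)
  have 0: "retract 0 z = z" if "z \<in> cut E" for z
    using in_cut[OF that] by (auto simp: retract_def pull_def edge_map_def)
  have 1: "retract 1 z \<in> Inl ` V" if "z \<in> cut E" for z
    using in_cut[OF that] funcset_mem[OF ends(1)] funcset_mem[OF ends(2)]
    by (auto simp: retract_def pull_def edge_map_def)
  have hom: "homotopic_with (\<lambda>_. True) ?Y ?Y id (retract 1)"
    by (subst homotopic_with, simp, intro exI[of _ "\<lambda>z. retract (fst z) (snd z)"] conjI continuous_retract)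
       (auto simp: 0)
  have hom': "homotopic_with (\<lambda>h. h \<in> {} \<rightarrow> {}) ?Y ?Y id (retract 1)"
    using hom by (rule homotopic_with_mono) auto
  have cont: "continuous_map ?Y ?Y (retract 1)"
    using homotopic_with_imp_continuous_maps[OF hom] by blast
  have contD: "continuous_map ?Y ?D (retract 1)"
    unfolding continuous_map
  proof (intro conjI allI impI)
    show "retract 1 ` topspace ?Y \<subseteq> topspace ?D"
      using 1 by (auto simp: topspace_cut)
    fix U assume U: "openin ?D U"
    \<comment> \<open>Every set of vertices is closed in the graph, since an edge meets it at most
      in its two ends. The preimage of \<open>U\<close> is therefore that of the open complement of
      the other vertices.\<close>
    have "openin G (topspace G - (Inl ` V - U))"
    proof (rule openinI)
      fix e assume e: "e \<in> E"
      have "{r \<in> {0..1}. edge_map s t e r \<in> topspace G - (Inl ` V - U)}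
          = {0..1} \<inter> - {r \<in> {0,1}. edge_map s t e r \<notin> U}"
      proof -
        have "edge_map s t e r \<in> Inl ` V \<longleftrightarrow> r \<in> {0,1}" for r
          using funcset_mem[OF ends(1) e] funcset_mem[OF ends(2) e] by (auto simp: edge_map_def)
        then show ?thesis
          using edge_map_in[OF e] by auto
      qed
      moreover have "finite {r \<in> {0,1::real}. edge_map s t e r \<notin> U}" by simp
      ultimately show "openin (top_of_set {0..1}) {r \<in> {0..1}. edge_map s t e r \<in> topspace G - (Inl ` V - U)}"
        by (simp add: finite_imp_closed open_Compl openin_open_Int)
    qed auto
    then have "openin ?Y (cut E \<inter> (topspace G - (Inl ` V - U)))"
      by (rule openin_subtopology_Int2)
    from openin_continuous_map_preimage[OF cont this]
    have "openin ?Y {z \<in> topspace ?Y. retract 1 z \<in> cut E \<inter> (topspace G - (Inl ` V - U))}" .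
    also have "{z \<in> topspace ?Y. retract 1 z \<in> cut E \<inter> (topspace G - (Inl ` V - U))} = {z \<in> topspace ?Y. retract 1 z \<in> U}"
    proof -
      have "retract 1 z \<in> cut E" if "z \<in> cut E" for z
        using 1[OF that] by (auto simp: topspace_G cut_def mid_def)
      then show ?thesis
        using 1 U cut_subset[of E] by (auto simp: topspace_cut)
    qed
    finally show "openin ?Y {z \<in> topspace ?Y. retract 1 z \<in> U}" .
  qed
  have inc: "continuous_map ?D ?Y id"
    by (auto simp: topspace_G cut_def mid_def)
  have "c = \<one>\<^bsub>homology_group 1 ?Y\<^esub>" if c: "c \<in> carrier (homology_group 1 ?Y)" for c
  proof -
    have "c = hom_induced 1 ?Y {} ?Y {} id c"
      using hom_induced_id[OF c] by simp
    also have "\<dots> = hom_induced 1 ?Y {} ?Y {} (id \<circ> retract 1) c"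
      using homology_homotopy_axiom[OF hom', of 1] by simp
    also have "\<dots> = hom_induced 1 ?D {} ?Y {} id (hom_induced 1 ?Y {} ?D {} (retract 1) c)"
      by (rule hom_induced_compose'[OF contD _ inc, symmetric]) auto
    also have "hom_induced 1 ?Y {} ?D {} (retract 1) c = \<one>\<^bsub>homology_group 1 ?D\<^esub>"
    proof -
      have "carrier (homology_group 1 ?D) = {\<one>\<^bsub>homology_group 1 ?D\<^esub>}"
        using trivial_homology_discrete[of 1 "Inl ` V :: ('v + 'e \<times> real) set"] by (simp add: trivial_group_def)
      then show ?thesis
        using hom_induced_carrier[of 1 ?Y "{}" ?D "{}" "retract 1" c] by (simp only: singleton_iff)
    qed
    also have "hom_induced 1 ?D {} ?Y {} id \<one>\<^bsub>homology_group 1 ?D\<^esub> = \<one>\<^bsub>homology_group 1 ?Y\<^esub>"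
      by (rule hom_one[OF hom_induced_hom]) auto
    finally show ?thesis .
  qed
  then have "carrier (homology_group 1 ?Y) = {\<one>\<^bsub>homology_group 1 ?Y\<^esub>}"
    using one_in_homology_group[of 1 ?Y "{}"] by blast
  then show ?thesis
    unfolding trivial_group_def by simp
qed

section \<open>Bridges and the complement of a spanning tree\<close>

lemma connectedin_arc:
  assumes "e \<in> E" "connected W" "W \<subseteq> {0<..<1}"
  shows "connectedin G (arc e W)"
proof -
  have "connectedin (top_of_set {0..1}) W"
    using assms(2,3) by (auto simp: connectedin_subtopology)
  then have "connectedin G (edge_map s t e ` W)"
    by (rule connectedin_continuous_map_image[OF continuous_edge_map[OF assms(1)]])
  also have "edge_map s t e ` W = arc e W"
    using assms(3) by (force simp: edge_map_def arc_def)
  finally show ?thesis .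
qed

lemma arc_cut_insert:
  "e \<in> E \<Longrightarrow> e \<notin> S \<Longrightarrow> W \<subseteq> {0<..<1} \<Longrightarrow> 1/2 \<notin> W \<Longrightarrow> arc e W \<subseteq> cut (insert e S)"
  by (auto simp: arc_def cut_def mid_def topspace_G)

lemma arc_halves: "arc e {0<..<1} = insert (mid e) (arc e {0<..<1/2} \<union> arc e {1/2<..<1})"
proof -
  have "{0<..<1} = insert (1/2) ({0<..<1/2} \<union> {1/2<..<1::real})"
    by auto
  then have "arc e {0<..<1} = arc e (insert (1/2) ({0<..<1/2} \<union> {1/2<..<1}))"
    by simp
  also have "\<dots> = insert (mid e) (arc e {0<..<1/2} \<union> arc e {1/2<..<1})"
    by (auto simp: arc_def mid_def)
  finally show ?thesis .
qed

text \<open>If both halves of \<open>e\<close> lay in \<open>C\<close>, restoring the midpoint would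
  merely enlarge \<open>C\<close> to an open set still disjoint from \<open>D\<close>, and
  \<open>cut S\<close> would be disconnected.\<close>

lemma connected_cut_one_side:
  assumes "S \<subseteq> E" "e \<in> E" "e \<notin> S" "connectedin G (cut S)"
    and CD: "openin G C" "openin G D" "C \<inter> D = {}" "C \<union> D = cut (insert e S)" "D \<noteq> {}"
  shows "\<not> (arc e {0<..<1/2} \<subseteq> C \<and> arc e {1/2<..<1} \<subseteq> C)"
proof
  assume *: "arc e {0<..<1/2} \<subseteq> C \<and> arc e {1/2<..<1} \<subseteq> C"
  let ?C = "C \<union> arc e {0<..<1}"
  have m: "mid e \<notin> C \<union> D"
    by (simp add: CD(4) cut_insert)
  have "openin G ?C"
    using CD(1) openin_arc[OF assms(2), of "{0<..<1}"] by auto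
  moreover have "cut S \<subseteq> ?C \<union> D"
    using CD(4) by (auto simp: cut_insert arc_halves)
  moreover have "?C \<inter> D = {}"
    using * CD(3) m by (auto simp: arc_halves)
  moreover have "mid e \<in> ?C \<inter> cut S"
    using arc_cut[OF assms(2,3), of "{0<..<1}"] by (auto simp: arc_halves)
  moreover have "D \<inter> cut S \<noteq> {}"
    using CD(4,5) by (auto simp: cut_insert)
  ultimately show False
    using assms(4) CD(2) unfolding connectedin by blast
qed

text \<open>Each half edge is connected, so it lies on one side of a separation, and the two halves
  cannot share a side. Swapping the sides if necessary puts the first half into
  \<open>C\<close>.\<close>

lemma bridge_split:
  assumes "S \<subseteq> E" "e \<in> E" "e \<notin> S" "connectedin G (cut S)" "\<not> connectedin G (cut (insert e S))"
  obtains C D where "openin G C" "openin G D" "C \<inter> D = {}" "C \<union> D = cut (insert e S)"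
    "arc e {0<..<1/2} \<subseteq> C" "arc e {1/2<..<1} \<subseteq> D"
proof -
  have "openin G (cut (insert e S))"
    using assms by (intro openin_cut) auto
  moreover obtain E1 E2 where E12: "openin G E1" "openin G E2" "cut (insert e S) \<subseteq> E1 \<union> E2"
    "E1 \<inter> E2 \<inter> cut (insert e S) = {}" "E1 \<inter> cut (insert e S) \<noteq> {}" "E2 \<inter> cut (insert e S) \<noteq> {}"
    using assms(5) cut_subset unfolding connectedin by blast
  moreover define C D where "C = E1 \<inter> cut (insert e S)" and "D = E2 \<inter> cut (insert e S)"
  ultimately have CD: "openin G C" "openin G D" "C \<inter> D = {}" "C \<union> D = cut (insert e S)" "C \<noteq> {}" "D \<noteq> {}"
    by auto
  have side: "arc e W \<subseteq> C \<or> arc e W \<subseteq> D" if "connected W" "W \<subseteq> {0<..<1}" "1/2 \<notin> W" for W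
  proof -
    have "arc e W \<subseteq> C \<union> D"
      unfolding CD(4) by (rule arc_cut_insert[OF assms(2,3) that(2,3)])
    moreover have "C \<inter> arc e W = {} \<or> D \<inter> arc e W = {}"
    proof (rule ccontr)
      assume "\<not> ?thesis"
      with CD(1-3) \<open>arc e W \<subseteq> C \<union> D\<close> connectedin_arc[OF assms(2) that(1,2)] show False
        unfolding connectedin by blast
    qed
    ultimately show ?thesis by blast
  qed
  have L: "arc e {0<..<1/2} \<subseteq> C \<or> arc e {0<..<1/2} \<subseteq> D"
    by (rule side) auto
  have R: "arc e {1/2<..<1} \<subseteq> C \<or> arc e {1/2<..<1} \<subseteq> D"
    by (rule side) auto
  have "\<not> (arc e {0<..<1/2} \<subseteq> C \<and> arc e {1/2<..<1} \<subseteq> C)"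
    by (rule connected_cut_one_side[OF assms(1-4) CD(1-4,6)])
  moreover have "\<not> (arc e {0<..<1/2} \<subseteq> D \<and> arc e {1/2<..<1} \<subseteq> D)"
    by (rule connected_cut_one_side[OF assms(1-4) CD(2,1)]) (use CD in auto)
  ultimately consider "arc e {0<..<1/2} \<subseteq> C" "arc e {1/2<..<1} \<subseteq> D" | "arc e {0<..<1/2} \<subseteq> D" "arc e {1/2<..<1} \<subseteq> C"
    using L R by blast
  then show ?thesis
  proof cases
    case 1
    with CD(1-4) show ?thesis by (rule that)
  next
    case 2
    have "D \<inter> C = {}" "D \<union> C = cut (insert e S)"
      using CD(3,4) by auto
    with CD(1,2) 2 show ?thesis by (intro that[of D C])
  qed
qed

text \<open>The order of restoring edges matters: those outside \<open>M\<close> come first, while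
  \<open>H_1\<close> is still trivial, because the bridge argument preserves triviality rather than
  a bound on the rank.\<close>

lemma spanning_tree_complement:
  assumes "finite E" "connected_space G"
  obtains M where "M \<subseteq> E" "connectedin G (cut M)" "rank_at_most (homology_group 1 G) (card M)"
proof -
  let ?H = "\<lambda>S. homology_group 1 (subtopology G (cut S))"
  define \<M> where "\<M> = {M. M \<subseteq> E \<and> connectedin G (cut M)}"
  have "finite \<M>"
    unfolding \<M>_def using assms(1) by simp
  moreover have "{} \<in> \<M>"
    using assms(2) by (simp add: \<M>_def cut_empty connectedin_topspace)
  then have "\<M> \<noteq> {}" by blast
  ultimately have "\<exists>M\<in>\<M>. \<forall>M'\<in>\<M>. M \<subseteq> M' \<longrightarrow> M = M'"
    by (rule finite_has_maximal)
  then obtain M where "M \<in> \<M>" and M_max: "\<forall>M'\<in>\<M>. M \<subseteq> M' \<longrightarrow> M = M'"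
    by (rule bexE)
  then have M: "M \<subseteq> E" "connectedin G (cut M)"
    by (simp_all add: \<M>_def)
  have max: "M = M'" if "M' \<subseteq> E" "connectedin G (cut M')" "M \<subseteq> M'" for M'
    using M_max that by (simp add: \<M>_def)
  have "finite M"
    using M(1) assms(1) by (rule finite_subset)
  \<comment> \<open>Maximality separates the graph cut at \<open>insert e M\<close>. Intersecting
    both sides with the smaller open set \<open>cut (insert e S)\<close> still keeps the halves of
    \<open>e\<close> apart, even if \<open>cut S\<close> itself is not connected.\<close>
  have bridge: "trivial_group (?H S)"
    if S: "M \<subseteq> S" "S \<subseteq> E" "e \<in> E" "e \<notin> S" and triv: "trivial_group (?H (insert e S))" for S e
  proof -
    have "\<not> connectedin G (cut (insert e M))"
      using max[of "insert e M"] S M by auto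
    moreover have "e \<notin> M" using S by auto
    ultimately obtain C D where CD: "openin G C" "openin G D" "C \<inter> D = {}" "C \<union> D = cut (insert e M)"
      "arc e {0<..<1/2} \<subseteq> C" "arc e {1/2<..<1} \<subseteq> D"
      using bridge_split[OF M(1) S(3) _ M(2)] by metis
    have op: "openin G (cut (insert e S))"
      using S by (intro openin_cut) auto
    have sub: "cut (insert e S) \<subseteq> cut (insert e M)"
      using S by (intro cut_antimono) auto
    have arcs: "arc e {0<..<1/2} \<subseteq> cut (insert e S)" "arc e {1/2<..<1} \<subseteq> cut (insert e S)"
      by (rule arc_cut_insert[OF S(3,4)]; auto)+
    show ?thesis
      by (rule trivial_cut_insert[OF S(2-4) openin_Int[OF CD(1) op] openin_Int[OF CD(2) op] _ _ _ _ triv])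
         (use CD(3-6) sub arcs in auto)
  qed
  \<comment> \<open>\<open>F\<close> collects the edges whose midpoints have been restored so
    far.\<close>
  have "trivial_group (?H (E - F))" if "finite F" "F \<subseteq> E - M" for F
    using that
  proof (induction F)
    case empty
    then show ?case using trivial_cut_all by simp
  next
    case (insert e F)
    then have eq: "insert e (E - insert e F) = E - F" by blast
    have "trivial_group (?H (E - F))"
      by (rule insert.IH) (use insert.prems in blast)
    then show ?case
      by (intro bridge[of "E - insert e F" e]) (use insert.prems M(1) in \<open>auto simp only: eq\<close>)
  qed
  from this[of "E - M"] have "trivial_group (?H M)"
    using assms(1) M(1) by (simp add: double_diff)
  then have 0: "rank_at_most (?H M) 0"
    by (rule trivial_group_rank)
  have "rank_at_most (?H (M - F)) (card F)" if "finite F" "F \<subseteq> M" for F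
    using that
  proof (induction F)
    case empty
    then show ?case using 0 by simp
  next
    case (insert e F)
    then have eq: "insert e (M - insert e F) = M - F" by blast
    have "rank_at_most (?H (M - F)) (card F)"
      by (rule insert.IH) (use insert.prems in blast)
    then have "rank_at_most (?H (M - insert e F)) (Suc (card F))"
      by (intro rank_cut_insert[of "M - insert e F" e]) (use insert.prems M(1) in \<open>auto simp only: eq\<close>)
    then show ?case
      using insert.hyps by simp
  qed
  from this[OF \<open>finite M\<close>] have "rank_at_most (homology_group 1 G) (card M)"
    by (simp add: cut_empty)
  with M show ?thesis by (rule that)
qed

end

section \<open>The Reeb graph\<close>

lemma contour_eq_iff:
  assumes "x \<in> X" "y \<in> X"
  shows "contour X f x = contour X f y \<longleftrightarrow> y \<in> contour X f x"
proof
  have "y \<in> contour X f y"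
    using assms unfolding contour_def by (simp add: connected_component_refl)
  then show "contour X f x = contour X f y \<Longrightarrow> y \<in> contour X f x"
    by simp
next
  assume y: "y \<in> contour X f x"
  then have "f y = f x"
    unfolding contour_def using connected_component_in by fastforce
  then show "contour X f x = contour X f y"
    using y unfolding contour_def by (simp add: connected_component_eq)
qed

text \<open>As \<open>h\<close> is injective, the fibres are the contours themselves. Monotonicity
  is what later pulls open connected sets of the graph back to connected sets.\<close>

lemma monotone_quotient_Reeb_graph:
  assumes "homeomorphic_map (Reeb_graph X f) Y h"
  shows "quotient_map (top_of_set X) Y (h \<circ> contour X f)" "monotone_map (top_of_set X) Y (h \<circ> contour X f)"
proof -
  let ?q = "h \<circ> contour X f"
  have Reeb: "quotient_map (top_of_set X) (Reeb_graph X f) (contour X f)"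
    unfolding Reeb_graph_def by (rule quotient_map_quotient_topology)
  show q: "quotient_map (top_of_set X) Y ?q"
    by (rule quotient_map_compose[OF Reeb]) (use assms in \<open>simp add: homeomorphic_map_def\<close>)
  have inj: "inj_on h (contour X f ` X)"
    using homeomorphic_imp_injective_map[OF assms] by (simp add: Reeb_graph_def)
  have "connectedin (top_of_set X) {x \<in> topspace (top_of_set X). ?q x = y}" if "y \<in> topspace Y" for y
  proof -
    have "?q ` X = topspace Y"
      using q by (auto simp: quotient_map_def)
    with that obtain x where x: "x \<in> X" "y = ?q x"
      by blast
    have sub: "contour X f x \<subseteq> X"
      unfolding contour_def using connected_component_subset by fastforce
    have "{z \<in> X. ?q z = y} = {z \<in> X. contour X f x = contour X f z}"
      using x inj by (auto simp: inj_on_eq_iff)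
    also have "\<dots> = contour X f x"
      using sub contour_eq_iff[OF x(1)] by blast
    finally have "{z \<in> X. ?q z = y} = contour X f x" .
    moreover have "connected (contour X f x)"
      unfolding contour_def by (rule connected_connected_component)
    ultimately show ?thesis
      using sub by (simp add: connectedin_subtopology)
  qed
  moreover have "?q ` topspace (top_of_set X) \<subseteq> topspace Y"
    using q by (auto simp: quotient_map_def)
  ultimately show "monotone_map (top_of_set X) Y ?q"
    unfolding monotone_map_def by blast
qed

lemma connected_imp_path_connected:
  assumes "locally path_connected S" "connected S"
  shows "path_connected S"
  using assms(2) unfolding path_connected_component connected_iff_connected_component
  by (simp add: path_component_eq_connected_component[OF assms(1)])

theorem theorem3p1:
  fixes X :: "'a::topological_space set" and f :: "'a \<Rightarrow> real" and x0 :: 'a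
  assumes "connected X"
    and "locally path_connected X"
    and "continuous_on X f"
    and "finite_topological_graph (Reeb_graph X f)"
    and "x0 \<in> X"
  shows "betti_number 1 (Reeb_graph X f) \<le> corank (fundamental_group X x0)"
proof -
  obtain V E :: "nat set" and s t where VE: "finite V" "finite E" "s \<in> E \<rightarrow> V" "t \<in> E \<rightarrow> V"
    and homeo: "Reeb_graph X f homeomorphic_space graph_realization V E s t"
    using assms(4) unfolding finite_topological_graph_def by blast
  interpret graph V E s t
    by unfold_locales (use VE in auto)
  obtain h where "homeomorphic_map (Reeb_graph X f) G h"
    using homeo unfolding homeomorphic_space by blast
  then obtain q where quo: "quotient_map (top_of_set X) G q" and mono: "monotone_map (top_of_set X) G q"
    using monotone_quotient_Reeb_graph by blast
  have "connected_space G"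
    using connected_space_quotient_map_image[OF quo] assms(1) by (simp add: connected_space_subtopology)
  with VE(2) obtain M where M: "M \<subseteq> E" "connectedin G (cut M)" "rank_at_most (homology_group 1 G) (card M)"
    by (rule spanning_tree_complement)
  define pre where "pre W = {x \<in> X. q x \<in> W}" for W
  have open_pre: "openin (top_of_set X) (pre W)" if "openin G W" for W
    using openin_continuous_map_preimage[OF quotient_imp_continuous_map[OF quo] that] by (simp add: pre_def)
  have path_pre: "path_connected (pre W)" if "openin G W" "connectedin G W" for W
  proof (rule connected_imp_path_connected)
    show "locally path_connected (pre W)"
      by (rule locally_open_subset[OF assms(2) open_pre[OF that(1)]])
    show "connected (pre W)"
      using connectedin_monotone_quotient_map_preimage[OF mono quo that(2)] that(1)
      by (simp add: pre_def connectedin_subtopology)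
  qed
  have q_image: "q ` X = topspace G"
    using quotient_imp_surjective_map[OF quo] by simp
  have pre_nonempty: "pre W \<noteq> {}" if "W \<subseteq> topspace G" "W \<noteq> {}" for W
  proof -
    from that(2) obtain y where y: "y \<in> W" by blast
    with that(1) have "y \<in> q ` X"
      unfolding q_image by (rule subsetD)
    then obtain x where "x \<in> X" "q x = y" by blast
    with y have "x \<in> pre W" by (simp add: pre_def)
    then show ?thesis by blast
  qed
  \<comment> \<open>The type of the labels is left general because two instances are used: classes
    of loops, as \<open>corank\<close> demands, and the edges themselves, with \<open>id\<close>,
    from which those classes are chosen.\<close>
  have epi: "epi (fundamental_group X x0) (free_group (j ` M)) \<noteq> {}" for j :: "nat \<Rightarrow> 'l"
  proof (rule fundamental_group_epi_free_group)
    show "path_connected X"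
      using assms(1,2) by (intro connected_imp_path_connected)
    show "openin (top_of_set X) (pre (cut M))" "path_connected (pre (cut M))"
      using M openin_cut[OF M(1)] open_pre path_pre by auto
    show "disjoint_family_on (\<lambda>e. pre (arc e {0<..<1})) M"
      by (auto simp: disjoint_family_on_def pre_def arc_def)
    show "X \<subseteq> pre (cut M) \<union> \<Union> ((\<lambda>e. pre (arc e {0<..<1})) ` M)"
      using q_image by (auto simp: pre_def cut_def arc_def mid_def)
    fix e assume e: "e \<in> M"
    then have eE: "e \<in> E" using M(1) by auto
    show "openin (top_of_set X) (pre (arc e {0<..<1}))" "path_connected (pre (arc e {0<..<1}))"
      "openin (top_of_set X) (pre (arc e {0<..<1/2}))" "openin (top_of_set X) (pre (arc e {1/2<..<1}))"
      using eE by (auto intro!: open_pre path_pre openin_arc connectedin_arc)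
    have "cut M \<inter> arc e {0<..<1} = arc e {0<..<1/2} \<union> arc e {1/2<..<1}"
    proof -
      have "arc e {0<..<1/2} \<union> arc e {1/2<..<1} \<subseteq> cut M"
        using eE by (auto simp: cut_def topspace_G arc_def mid_def)
      moreover have "mid e \<notin> cut M"
        using e by (simp add: cut_def)
      ultimately show ?thesis
        unfolding arc_halves by auto
    qed
    then show "pre (cut M) \<inter> pre (arc e {0<..<1}) = pre (arc e {0<..<1/2}) \<union> pre (arc e {1/2<..<1})"
      by (auto simp: pre_def)
    show "pre (arc e {0<..<1/2}) \<inter> pre (arc e {1/2<..<1}) = {}"
      by (auto simp: pre_def arc_def)
    have ne: "pre (arc e W) \<noteq> {}" if "W \<subseteq> {0<..<1}" "W \<noteq> {}" for W
      using arc_subset[OF eE that(1)] that(2) by (intro pre_nonempty) (auto simp: arc_def)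
    show "pre (arc e {0<..<1/2}) \<noteq> {}"
      by (rule ne) auto
    show "pre (arc e {1/2<..<1}) \<noteq> {}"
      by (rule ne) auto
  qed (use assms(5) in auto)
  have "homology_group 1 G \<cong> homology_group 1 (Reeb_graph X f)"
    by (rule homeomorphic_space_imp_isomorphic_homology_groups[OF iffD1[OF homeomorphic_space_sym homeo]])
  then obtain \<theta> where "\<theta> \<in> iso (homology_group 1 G) (homology_group 1 (Reeb_graph X f))"
    unfolding is_iso_def by auto
  then have "\<theta> \<in> epi (homology_group 1 G) (homology_group 1 (Reeb_graph X f))"
    by (simp add: iso_iff_mon_epi)
  then have "rank_at_most (homology_group 1 (Reeb_graph X f)) (card M)"
    by (rule rank_at_most_epi[OF abelian_homology_group abelian_homology_group _ M(3)])
  then have "betti_number 1 (Reeb_graph X f) \<le> enat (card M)"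
    unfolding betti_number_def by (intro abelian_rank_le abelian_homology_group)
  also have "\<dots> \<le> corank (fundamental_group X x0)"
  proof (rule card_le_corank[OF finite_subset[OF M(1) VE(2)] epi])
    show "epi (fundamental_group X x0) (free_group M) \<noteq> {}"
      using epi[of id] by simp
  qed
  finally show ?thesis .
qed

end
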